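(* Let $\alpha\in(0,0.3738)$ and $\beta\in(1,2)$, and assume the temporal stepsize $\tau$ and spatial stepsize $h$ are sufficiently small. Then the two-dimensional L1-2 scheme in the context is numerically stable and its solution satisfies $$\|\mathbf U^n\|_{L^2_h}\le\|\mathbf U^0\|_{L^2_h}+C^{(\alpha)}\max_{1\le k\le n}\big\{(k\tau)^{\alpha}\|\mathbf F^k\|_{L^2_h}\big\},\qquad 1\le n\le N,$$ where $C^{(\alpha)}=\max\Big\{\frac{6\Gamma(1-\alpha)}{\tilde a^{\alpha}},\frac{3\Gamma(2-\alpha)}{\alpha\tilde a^{\alpha}}\Big\}$.
   Context: Time grid: $\tilde a>0$, $T>\tilde a$, $N\in\mathbb{Z}^+$, $\tau=(T-\tilde a)/N$, $t_k=\tilde a+k\tau$. L1-2 coefficients: $a^{(\alpha)}_{i,k}=(\log\frac{t_k}{t_{i-1}})^{1-\alpha}-(\log\frac{t_k}{t_i})^{1-\alpha}$; for $i\ge2$, $b^{(\alpha)}_{i,k}=\frac{1}{\log\frac{t_i}{t_{i-2}}}\{\log\frac{t_i}{t_{i-1}}[(\log\frac{t_k}{t_i})^{1-\alpha}+(\log\frac{t_k}{t_{i-1}})^{1-\alpha}]+\frac{2}{2-\alpha}[(\log\frac{t_k}{t_i})^{2-\alpha}-(\log\frac{t_k}{t_{i-1}})^{2-\alpha}]\}$; $c^{(\alpha)}_{1,1}=\frac{a^{(\alpha)}_{1,1}}{\Gamma(2-\alpha)\log\frac{t_1}{t_0}}$; for $k\ge2$: $c^{(\alpha)}_{1,k}=\frac{a^{(\alpha)}_{1,k}+b^{(\alpha)}_{2,k}}{\Gamma(2-\alpha)\log\frac{t_1}{t_0}}$,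 $c^{(\alpha)}_{i,k}=\frac{a^{(\alpha)}_{i,k}-b^{(\alpha)}_{i,k}+b^{(\alpha)}_{i+1,k}}{\Gamma(2-\alpha)\log\frac{t_i}{t_{i-1}}}$ ($2\le i\le k-1$), $c^{(\alpha)}_{k,k}=\frac{a^{(\alpha)}_{k,k}-b^{(\alpha)}_{k,k}}{\Gamma(2-\alpha)\log\frac{t_k}{t_{k-1}}}$. Space grid: $L>0$, $M\in\mathbb{Z}^+$, $h=2L/M$, $x_j=-L+jh$, $y_k=-L+kh$; grid functions are $0$ unless $1\le j,k\le M-1$; $(w,v)_{h^2}=h^2\sum_{j,k=1}^{M-1}w_{jk}v_{jk}$, $\|w\|^2_{L^2_h}=(w,w)_{h^2}$; $((-\Delta_h)^{\beta/2}w)_{jk}=h^{-\beta}\sum_{l,m\in\mathbb{Z}}a^{(\beta)}_{l,m}w_{j+l,k+m}$, $a^{(\beta)}_{l,m}=\frac{1}{4\pi^2}\int_{-\pi}^{\pi}\int_{-\pi}^{\pi}[4\sin^2\frac{\eta_1}{2}+4\sin^2\frac{\eta_2}{2}]^{\beta/2}e^{-\mathbf{i}(\eta_1l+\eta_2m)}d\eta_1d\eta_2$. Scheme (with $\mathbf F^n=(f(x_j,y_k,t_n))_{j,k}$, $\mathbf U^n=(U^n_{jk})$): $c^{(\alpha)}_{1,1}U^1_{jk}-c^{(\alpha)}_{1,1}U^0_{jk}+((-\Delta_h)^{\beta/2}U^1)_{jk}=f(x_j,y_k,t_1)$; for $2\le n\le N$: $c^{(\alpha)}_{n,n}U^n_{jk}+\sum_{i=1}^{n-1}(c^{(\alpha)}_{i,n}-c^{(\alpha)}_{i+1,n})U^i_{jk}-c^{(\alpha)}_{1,n}U^0_{jk}+((-\Delta_h)^{\beta/2}U^n)_{jk}=f(x_j,y_k,t_n)$;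 for $1\le j,k\le M-1$; $U^0_{jk}=u_0(x_j,y_k)$; $U^n_{jk}=0$ at boundary grid points. *)

theory Defs
  imports "HOL-Analysis.Analysis"
begin

definition tgrid :: "real \<Rightarrow> real \<Rightarrow> nat \<Rightarrow> nat \<Rightarrow> real" where
  "tgrid a0 T N k = a0 + real k * ((T - a0) / real N)"

definition a_coef :: "real \<Rightarrow> (nat \<Rightarrow> real) \<Rightarrow> nat \<Rightarrow> nat \<Rightarrow> real" where
  "a_coef \<alpha> t i k = ln (t k / t (i - 1)) powr (1 - \<alpha>) - ln (t k / t i) powr (1 - \<alpha>)"

definition b_coef :: "real \<Rightarrow> (nat \<Rightarrow> real) \<Rightarrow> nat \<Rightarrow> nat \<Rightarrow> real" where
  "b_coef \<alpha> t i k = (1 / ln (t i / t (i - 2))) *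
     (ln (t i / t (i - 1)) * (ln (t k / t i) powr (1 - \<alpha>) + ln (t k / t (i - 1)) powr (1 - \<alpha>))
      + 2 / (2 - \<alpha>) * (ln (t k / t i) powr (2 - \<alpha>) - ln (t k / t (i - 1)) powr (2 - \<alpha>)))"

definition c_coef :: "real \<Rightarrow> (nat \<Rightarrow> real) \<Rightarrow> nat \<Rightarrow> nat \<Rightarrow> real" where
  "c_coef \<alpha> t i k =
    (if i = 1 \<and> k = 1 then a_coef \<alpha> t 1 1 / (Gamma (2 - \<alpha>) * ln (t 1 / t 0))
     else if i = 1 then (a_coef \<alpha> t 1 k + b_coef \<alpha> t 2 k) / (Gamma (2 - \<alpha>) * ln (t 1 / t 0))
     else if i = k then (a_coef \<alpha> t k k - b_coef \<alpha> t k k) / (Gamma (2 - \<alpha>) * ln (t k / t (k - 1)))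
     else (a_coef \<alpha> t i k - b_coef \<alpha> t i k + b_coef \<alpha> t (i + 1) k) / (Gamma (2 - \<alpha>) * ln (t i / t (i - 1))))"

text \<open>Coefficients of the discrete fractional Laplacian (the integral is real; we take Re of
  the complex integral).\<close>
definition frac_coef :: "real \<Rightarrow> int \<Rightarrow> int \<Rightarrow> real" where
  "frac_coef \<beta> l m = Re (integral (cbox (-pi, -pi) (pi, pi))
      (\<lambda>(e1, e2). complex_of_real ((4 * (sin (e1 / 2))^2 + 4 * (sin (e2 / 2))^2) powr (\<beta> / 2))
                   * cis (- (e1 * real_of_int l + e2 * real_of_int m)))) / (4 * pi^2)"

text \<open>((-Delta_h)^{beta/2} w)_{jk}; grid functions vanish outside 1..M-1, so the sum over
  all (l,m) in Z^2 reduces to indices (j+l, k+m) in the interior.\<close>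
definition frac_lap :: "real \<Rightarrow> real \<Rightarrow> nat \<Rightarrow> (nat \<Rightarrow> nat \<Rightarrow> real) \<Rightarrow> nat \<Rightarrow> nat \<Rightarrow> real" where
  "frac_lap \<beta> h M w j k = h powr (- \<beta>) *
     (\<Sum>p\<in>{1..M-1}. \<Sum>q\<in>{1..M-1}. frac_coef \<beta> (int p - int j) (int q - int k) * w p q)"

definition l2h_norm :: "real \<Rightarrow> nat \<Rightarrow> (nat \<Rightarrow> nat \<Rightarrow> real) \<Rightarrow> real" where
  "l2h_norm h M w = sqrt (h^2 * (\<Sum>j\<in>{1..M-1}. \<Sum>k\<in>{1..M-1}. (w j k)^2))"

definition L12_solution ::
  "real \<Rightarrow> real \<Rightarrow> real \<Rightarrow> real \<Rightarrow> real \<Rightarrow> nat \<Rightarrow> nat \<Rightarrow>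
   (real \<Rightarrow> real \<Rightarrow> real) \<Rightarrow> (real \<Rightarrow> real \<Rightarrow> real \<Rightarrow> real) \<Rightarrow>
   (nat \<Rightarrow> nat \<Rightarrow> nat \<Rightarrow> real) \<Rightarrow> bool" where
  "L12_solution \<alpha> \<beta> a0 T L N M u0 f U \<longleftrightarrow>
    (let t = tgrid a0 T N; h = 2 * L / real M; x = (\<lambda>j. - L + real j * h) in
     (\<forall>j\<in>{1..M-1}. \<forall>k\<in>{1..M-1}.
        c_coef \<alpha> t 1 1 * U 1 j k - c_coef \<alpha> t 1 1 * U 0 j k + frac_lap \<beta> h M (U 1) j k
          = f (x j) (x k) (t 1)) \<and>
     (\<forall>n\<in>{2..N}. \<forall>j\<in>{1..M-1}. \<forall>k\<in>{1..M-1}.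
        c_coef \<alpha> t n n * U n j k
        + (\<Sum>i\<in>{1..n-1}. (c_coef \<alpha> t i n - c_coef \<alpha> t (i + 1) n) * U i j k)
        - c_coef \<alpha> t 1 n * U 0 j k + frac_lap \<beta> h M (U n) j k
          = f (x j) (x k) (t n)) \<and>
     (\<forall>j\<in>{1..M-1}. \<forall>k\<in>{1..M-1}. U 0 j k = u0 (x j) (x k)) \<and>
     (\<forall>n\<in>{1..N}. \<forall>j\<le>M. \<forall>k\<le>M. (j = 0 \<or> j = M \<or> k = 0 \<or> k = M) \<longrightarrow> U n j k = 0))"

end

theory Submission
  imports Defs
begin

text \<open>
  In the variable \<open>s = ln t\<close> the weights of the scheme are
  \<open>w i = A i + (B i - B (i + 1)) / d i\<close>, where \<open>d i\<close> is a step, \<open>A i\<close> is the slope of the concave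
  function \<open>\<phi>(y) = y powr (1 - \<alpha>)\<close> over that step and \<open>B i \<ge> 0\<close> is the error of the trapezoidal rule
  for \<open>\<phi>\<close>, divided by the sum of two adjacent steps. Stability follows by an energy argument and
  induction once the weights increase in \<open>i\<close> and the first one is bounded from below.

  The steps decrease, and adjacent ones have ratio at most \<open>1 + 2 \<tau> / a0\<close>. Away from the current time
  the gain \<open>A (i + 1) - A i\<close> beats the correction terms by plain second derivative bounds. For the last three
  weights the differences are continuous functions of the step ratios, so for small \<open>\<tau>\<close> it suffices
  that they are positive on a uniform mesh; this is where \<open>\<alpha> < 0.3738\<close> comes from.
\<close>

section \<open>The trapezoidal defect of a power function\<close>

text \<open>Twice the amount by which the integral of \<open>y powr (1 - \<alpha>)\<close> over
  \<open>[p, q]\<close> exceeds its trapezoidal value. Concavity of the integrand makes it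
  nonnegative.\<close>

definition trap_defect :: "real \<Rightarrow> real \<Rightarrow> real \<Rightarrow> real" where
  "trap_defect \<alpha> p q = 2 / (2 - \<alpha>) * (q powr (2 - \<alpha>) - p powr (2 - \<alpha>))
     - (q - p) * (p powr (1 - \<alpha>) + q powr (1 - \<alpha>))"

text \<open>The interval that ends at the current time has left end \<open>0\<close>, where the
  integrand has no finite derivative; an exact value takes the place of a second derivative
  bound.\<close>

lemma trap_defect_zero_left:
  assumes "0 < \<alpha>" "\<alpha> < 1" "0 \<le> q"
  shows "trap_defect \<alpha> 0 q = \<alpha> / (2 - \<alpha>) * q powr (2 - \<alpha>)"
proof -
  have "q * q powr (1 - \<alpha>) = q powr (2 - \<alpha>)"
    using assms powr_mult_base[of q "1 - \<alpha>"] by (simp add: add.commute)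
  then show ?thesis
    using assms by (simp add: trap_defect_def field_simps)
qed

text \<open>The derivative of the defect in \<open>q\<close> is \<open>g\<close>, and
  \<open>g\<close> itself has derivative \<open>(y - p) * (\<alpha> * (1 - \<alpha>) * y powr
  (-\<alpha> - 1))\<close>. The second factor is positive and largest at \<open>p\<close>, where it
  equals \<open>K\<close>, so integrating twice gives both bounds.\<close>

lemma trap_defect_bounds_pos:
  assumes "0 < \<alpha>" "\<alpha> < 1" "0 < p" "p \<le> q"
  shows "0 \<le> trap_defect \<alpha> p q"
    and "trap_defect \<alpha> p q \<le> \<alpha> * (1 - \<alpha>) * p powr (-\<alpha> - 1) * (q - p) ^ 3 / 6"
proof -
  define K where "K = \<alpha> * (1 - \<alpha>) * p powr (-\<alpha> - 1)"
  define g where "g = (\<lambda>y. y powr (1 - \<alpha>) - p powr (1 - \<alpha>) - (y - p) * ((1 - \<alpha>) * y powr (-\<alpha>)))"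
  have dg: "(g has_real_derivative (y - p) * (\<alpha> * (1 - \<alpha>) * y powr (-\<alpha> - 1))) (at y)"
    if "p \<le> y" for y
    using that assms unfolding g_def
    by (auto intro!: derivative_eq_intros simp: algebra_simps)
  have g_nonneg: "0 \<le> g y" if "p \<le> y" for y
  proof -
    have "g p \<le> g y"
      using that assms dg by (intro DERIV_nonneg_imp_nondecreasing[of p y g]) fastforce+
    then show ?thesis by (simp add: g_def)
  qed
  have g_le: "g y \<le> K * (y - p)\<^sup>2 / 2" if "p \<le> y" for y
  proof -
    have "K * (p - p)\<^sup>2 / 2 - g p \<le> K * (y - p)\<^sup>2 / 2 - g y"
    proof (rule DERIV_nonneg_imp_nondecreasing[of p y "\<lambda>y. K * (y - p)\<^sup>2 / 2 - g y"])
      fix z assume z: "p \<le> z" "z \<le> y"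
      have "((\<lambda>y. K * (y - p)\<^sup>2 / 2 - g y) has_real_derivative
          K * (z - p) - (z - p) * (\<alpha> * (1 - \<alpha>) * z powr (-\<alpha> - 1))) (at z)"
        by (rule derivative_eq_intros dg z refl | simp)+
      moreover have "z powr (-\<alpha> - 1) \<le> p powr (-\<alpha> - 1)"
        using assms z by (intro powr_mono2') auto
      then have "(z - p) * (\<alpha> * (1 - \<alpha>) * z powr (-\<alpha> - 1)) \<le> (z - p) * K"
        unfolding K_def using assms z by (intro mult_left_mono) auto
      ultimately show "\<exists>D. ((\<lambda>y. K * (y - p)\<^sup>2 / 2 - g y) has_real_derivative D) (at z) \<and> 0 \<le> D"
        by (intro exI[of _ "K * (z - p) - (z - p) * (\<alpha> * (1 - \<alpha>) * z powr (-\<alpha> - 1))"])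
          (simp add: mult.commute)
    qed (use that in simp)
    then show ?thesis by (simp add: g_def)
  qed
  have dE: "(trap_defect \<alpha> p has_real_derivative g y) (at y)" if "p \<le> y" for y
  proof -
    have d2: "((\<lambda>q. 2 / (2 - \<alpha>) * (q powr (2 - \<alpha>) - p powr (2 - \<alpha>))) has_real_derivative
        2 / (2 - \<alpha>) * ((2 - \<alpha>) * y powr (1 - \<alpha>))) (at y)"
      using that assms by (intro DERIV_cmult) (auto intro!: derivative_eq_intros)
    have d3: "((\<lambda>q. (q - p) * (p powr (1 - \<alpha>) + q powr (1 - \<alpha>))) has_real_derivative
        (p powr (1 - \<alpha>) + y powr (1 - \<alpha>)) + (y - p) * ((1 - \<alpha>) * y powr (-\<alpha>))) (at y)"
      using that assms by (auto intro!: derivative_eq_intros)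
    have "2 / (2 - \<alpha>) * ((2 - \<alpha>) * y powr (1 - \<alpha>)) = 2 * y powr (1 - \<alpha>)"
      using assms by simp
    then have "2 / (2 - \<alpha>) * ((2 - \<alpha>) * y powr (1 - \<alpha>))
        - ((p powr (1 - \<alpha>) + y powr (1 - \<alpha>)) + (y - p) * ((1 - \<alpha>) * y powr (-\<alpha>))) = g y"
      by (simp add: g_def)
    then have "((\<lambda>q. 2 / (2 - \<alpha>) * (q powr (2 - \<alpha>) - p powr (2 - \<alpha>))
        - (q - p) * (p powr (1 - \<alpha>) + q powr (1 - \<alpha>))) has_real_derivative g y) (at y)"
      using DERIV_diff[OF d2 d3] by (simp only:)
    then show ?thesis by (simp add: trap_defect_def[abs_def])
  qed
  have E0: "trap_defect \<alpha> p p = 0" by (simp add: trap_defect_def)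
  have "trap_defect \<alpha> p p \<le> trap_defect \<alpha> p q"
    using assms dE g_nonneg by (intro DERIV_nonneg_imp_nondecreasing[of p q "trap_defect \<alpha> p"]) auto
  then show "0 \<le> trap_defect \<alpha> p q" by (simp add: E0)
  have "K * (p - p) ^ 3 / 6 - trap_defect \<alpha> p p \<le> K * (q - p) ^ 3 / 6 - trap_defect \<alpha> p q"
  proof (rule DERIV_nonneg_imp_nondecreasing[of p q "\<lambda>y. K * (y - p) ^ 3 / 6 - trap_defect \<alpha> p y"])
    fix z assume z: "p \<le> z" "z \<le> q"
    have "((\<lambda>y. K * (y - p) ^ 3 / 6 - trap_defect \<alpha> p y) has_real_derivative
        K * (z - p)\<^sup>2 / 2 - g z) (at z)"
      by (rule derivative_eq_intros dE z refl | simp)+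
    then show "\<exists>D. ((\<lambda>y. K * (y - p) ^ 3 / 6 - trap_defect \<alpha> p y) has_real_derivative D) (at z) \<and> 0 \<le> D"
      using g_le[of z] z by (intro exI[of _ "K * (z - p)\<^sup>2 / 2 - g z"]) simp
  qed (use assms in simp)
  then show "trap_defect \<alpha> p q \<le> \<alpha> * (1 - \<alpha>) * p powr (-\<alpha> - 1) * (q - p) ^ 3 / 6"
    by (simp add: E0 K_def)
qed

lemma trap_defect_nonneg:
  assumes "0 < \<alpha>" "\<alpha> < 1" "0 \<le> p" "p \<le> q"
  shows "0 \<le> trap_defect \<alpha> p q"
  using assms trap_defect_bounds_pos(1)[of \<alpha> p q] trap_defect_zero_left[of \<alpha> q]
  by (cases "p = 0") auto

text \<open>Homogeneity of degree \<open>2 - \<alpha>\<close>, which lets the last step of the mesh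
  be scaled to \<open>1\<close>.\<close>

lemma trap_defect_scale:
  assumes "0 < w" "0 \<le> p" "0 \<le> q"
  shows "trap_defect \<alpha> (w * p) (w * q) = w powr (2 - \<alpha>) * trap_defect \<alpha> p q"
proof -
  have "w * w powr (1 - \<alpha>) = w powr (2 - \<alpha>)"
    using assms powr_mult_base[of w "1 - \<alpha>"] by (simp add: add.commute)
  then have "(w * q - w * p) * (w powr (1 - \<alpha>) * v) = w powr (2 - \<alpha>) * ((q - p) * v)" for v
    by (metis mult.assoc mult.left_commute right_diff_distrib)
  note eq = this[of "p powr (1 - \<alpha>) + q powr (1 - \<alpha>)"]
  show ?thesis
    unfolding trap_defect_def powr_mult distrib_left[symmetric] eq
    by (simp add: algebra_simps)
qed

text \<open>The two slopes are compared along the common parameter \<open>u\<close>, with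
  \<open>g(u) = (\<phi>(q) - \<phi>(q - u e)) / e - (\<phi>(r) - \<phi>(r - u d)) / d\<close> and \<open>\<phi>(y) = y powr (1 - \<alpha>)\<close>.\<close>
lemma powr_slope_diff:
  fixes \<alpha> p q r :: real
  assumes "0 < \<alpha>" "\<alpha> < 1" "0 < p" "p < q" "q < r" "q - p \<le> r - q"
  shows "(q - p) * (\<alpha> * (1 - \<alpha>) * r powr (-\<alpha> - 1))
    \<le> (q powr (1 - \<alpha>) - p powr (1 - \<alpha>)) / (q - p) - (r powr (1 - \<alpha>) - q powr (1 - \<alpha>)) / (r - q)"
proof -
  define d e where "d = r - q" and "e = q - p"
  have de: "0 < d" "0 < e" "e \<le> d" "r = q + d" "p = q - e" using assms by (auto simp: d_def e_def)
  define g where "g = (\<lambda>u. (q powr (1 - \<alpha>) - (q - u * e) powr (1 - \<alpha>)) / e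
    - (r powr (1 - \<alpha>) - (r - u * d) powr (1 - \<alpha>)) / d)"
  have dg: "(g has_real_derivative (1 - \<alpha>) * ((q - u * e) powr (-\<alpha>) - (r - u * d) powr (-\<alpha>))) (at u)"
    if "0 \<le> u" "u \<le> 1" for u
  proof -
    have "u * e \<le> e" "u * d \<le> d" using that de by (auto simp: mult_left_le_one_le)
    then have "0 < q - u * e" "0 < r - u * d" using de assms by linarith+
    then show ?thesis
      unfolding g_def using de by (auto intro!: derivative_eq_intros simp: field_simps)
  qed
  obtain u where u: "0 < u" "u < 1"
    "g 1 - g 0 = (1 - 0) * ((1 - \<alpha>) * ((q - u * e) powr (-\<alpha>) - (r - u * d) powr (-\<alpha>)))"
    using MVT2[of 0 1 g "\<lambda>u. (1 - \<alpha>) * ((q - u * e) powr (-\<alpha>) - (r - u * d) powr (-\<alpha>))"] dg by auto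
  have ue: "u * e \<le> e" "u * d \<le> d" "0 \<le> u * d" "0 \<le> u * e"
    using u de by (auto simp: mult_left_le_one_le)
  \<comment> \<open>The distance of the two shifted points is \<open>d - u * (d - e)\<close>, which
    decreases from \<open>d\<close> to \<open>e\<close> as \<open>u\<close> runs from
    \<open>0\<close> to \<open>1\<close>; this is where \<open>e \<le> d\<close> enters.\<close>
  have "u * (d - e) \<le> d - e" using u de by (intro mult_left_le_one_le) auto
  then have gap: "e \<le> (r - u * d) - (q - u * e)" using de by (simp add: algebra_simps)
  define y z where "y = q - u * e" and "z = r - u * d"
  have yz: "0 < y" "y < z" "z \<le> r" "e \<le> z - y"
    using ue de gap assms unfolding y_def z_def by linarith+
  have dp: "((\<lambda>y. y powr (-\<alpha>)) has_real_derivative -\<alpha> * v powr (-\<alpha> - 1)) (at v)" if "y \<le> v" for v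
    using that yz by (auto intro!: derivative_eq_intros)
  obtain v where v: "y < v" "v < z" "z powr (-\<alpha>) - y powr (-\<alpha>) = (z - y) * (-\<alpha> * v powr (-\<alpha> - 1))"
    using MVT2[of y z "\<lambda>y. y powr (-\<alpha>)" "\<lambda>v. -\<alpha> * v powr (-\<alpha> - 1)"] dp yz by auto
  have "r powr (-\<alpha> - 1) \<le> v powr (-\<alpha> - 1)"
    using assms v yz by (intro powr_mono2') auto
  then have "e * (\<alpha> * r powr (-\<alpha> - 1)) \<le> (z - y) * (\<alpha> * v powr (-\<alpha> - 1))"
    using yz assms de by (intro mult_mono) auto
  then have "e * (\<alpha> * r powr (-\<alpha> - 1)) \<le> y powr (-\<alpha>) - z powr (-\<alpha>)" using v by simp
  then have "(1 - \<alpha>) * (e * (\<alpha> * r powr (-\<alpha> - 1))) \<le> (1 - \<alpha>) * (y powr (-\<alpha>) - z powr (-\<alpha>))"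
    using assms by (intro mult_left_mono) auto
  also have "\<dots> = g 1" using u by (simp add: y_def z_def) (simp add: g_def)
  also have "\<dots> = (q powr (1 - \<alpha>) - p powr (1 - \<alpha>)) / (q - p) - (r powr (1 - \<alpha>) - q powr (1 - \<alpha>)) / (r - q)"
    by (simp add: g_def d_def e_def)
  finally show ?thesis by (simp add: e_def mult_ac)
qed

section \<open>The threshold exponent\<close>

text \<open>Reduces a lower bound for a power with rational exponent to an inequality between
  integer powers, which exact arithmetic can decide.\<close>

lemma le_powr_ratioI:
  fixes b x :: real
  assumes "0 < b" "0 < n" "x ^ n \<le> b ^ m"
  shows "x \<le> b powr (real m / real n)"
proof (rule ccontr)
  assume "\<not> ?thesis"
  then have "(b powr (real m / real n)) ^ n < x ^ n"
    using assms by (intro power_strict_mono) auto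
  moreover have "(b powr (real m / real n)) ^ n = b ^ m"
    using assms by (simp flip: powr_realpow add: powr_powr)
  ultimately show False using assms by simp
qed

text \<open>Together with \<open>power_le_odd\<close> this is repeated squaring for upper bounds.
  The premise \<open>a * a \<le> b\<close> permits rounding up after every squaring, so the numerals
  stay short.\<close>

lemma power_le_even:
  fixes x :: real
  assumes "0 \<le> x" "x ^ n \<le> a" "m = 2 * n" "a * a \<le> b"
  shows "x ^ m \<le> b"
proof -
  have "x ^ m = x ^ n * x ^ n" using assms by (simp add: mult_2 power_add)
  also have "\<dots> \<le> a * a" using assms by (intro mult_mono) (auto intro: order_trans[of _ "x ^ n"])
  finally show ?thesis using assms by simp
qed

lemma power_le_odd:
  fixes x :: real
  assumes "0 \<le> x" "x \<le> c" "x ^ n \<le> a" "m = 2 * n + 1" "a * a * c \<le> b"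
  shows "x ^ m \<le> b"
proof -
  have "x ^ m = x ^ (2 * n) * x" using assms by simp
  also have "\<dots> \<le> (a * a) * c"
    using assms power_le_even[of x n a "2 * n" "a * a"] by (intro mult_mono) auto
  finally show ?thesis using assms by simp
qed

text \<open>From \<open>2 ^ 11 = 2048 < 2187 = 3 ^ 7\<close> and
  \<open>ln 2 \<ge> 2 / 3\<close>.\<close>

lemma ln3_ge: "22 / 21 \<le> ln (3::real)"
proof -
  have "ln ((2::real) ^ 11) \<le> ln (3 ^ 7)" by (subst ln_le_cancel_iff) simp_all
  then have "11 * ln 2 \<le> 7 * ln (3::real)" 
    by (subst (asm) (1 2) ln_realpow) simp_all
  then show ?thesis using ln2_ge_two_thirds by simp
qed

text \<open>The function below vanishes at \<open>0\<close> and next at \<open>a = 0.373866...\<close>; the fraction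
  \<open>40 / 107 = 0.373831...\<close> lies between this root and the bound \<open>0.3738\<close> of the theorem and has a
  denominator small enough for exact arithmetic.\<close>
lemma threshold_pos:
  fixes a :: real
  assumes "0 < a" "a \<le> 40 / 107"
  shows "0 < 12 * 2 powr (-a) - 8 * 3 powr (-a) - 4 - a * (2 * 2 powr (-a) - 1 - 3 powr (-a))"
proof -
  define H where "H = (\<lambda>a::real. 12 * 2 powr (-a) - 8 * 3 powr (-a) - 4 - a * (2 * 2 powr (-a) - 1 - 3 powr (-a)))"
  define H1 where "H1 = (\<lambda>a::real. - 12 * ln 2 * 2 powr (-a) + 8 * ln 3 * 3 powr (-a)
    - (2 * 2 powr (-a) - 1 - 3 powr (-a)) + a * (2 * ln 2 * 2 powr (-a) - ln 3 * 3 powr (-a)))"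
  define H2 where "H2 = (\<lambda>a::real. 12 * (ln 2)\<^sup>2 * 2 powr (-a) - 8 * (ln 3)\<^sup>2 * 3 powr (-a)
    + 2 * (2 * ln 2 * 2 powr (-a) - ln 3 * 3 powr (-a))
    + a * ((ln 3)\<^sup>2 * 3 powr (-a) - 2 * (ln 2)\<^sup>2 * 2 powr (-a)))"
  \<comment> \<open>A concave function that vanishes at \<open>0\<close> and is positive at the
    right end of an interval is positive in between, so a single numerical evaluation
    suffices.\<close>
  have "concave_on {0..40/107} H"
  proof (rule f''_le0_imp_concave)
    show "(H has_real_derivative H1 x) (at x)" for x
      unfolding H_def H1_def by (auto intro!: derivative_eq_intros simp: algebra_simps)
    show "(H1 has_real_derivative H2 x) (at x)" for x
      unfolding H1_def H2_def by (auto intro!: derivative_eq_intros simp: algebra_simps power2_eq_square)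
    fix x :: real assume x: "x \<in> {0..40/107}"
    define P Q where "P = 2 powr (-x)" and "Q = 3 powr (-x)"
    have pos: "0 < P" "0 < Q" by (auto simp: P_def Q_def)
    \<comment> \<open>The positive part of \<open>H2\<close> carries \<open>P\<close> and the
      dominant negative part carries \<open>Q\<close>, so \<open>P\<close> has to be bounded by a
      multiple of \<open>Q\<close>. The exponent \<open>2 / 5\<close> is a simple upper bound for
      \<open>40 / 107\<close>.\<close>
    have "50 / 59 \<le> (2/3::real) powr (real 2 / real 5)"
      by (rule le_powr_ratioI) (simp_all add: eval_nat_numeral)
    also have "\<dots> \<le> (2/3) powr x" using x by (intro powr_mono') auto
    finally have "50 / 59 * P \<le> (2/3) powr x * P" using pos by (intro mult_right_mono) auto
    also have "(2/3) powr x * P = Q"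
      by (simp add: P_def Q_def powr_minus powr_divide field_simps)
    finally have PQ: "P \<le> 59/50 * Q" by simp
    have l2: "ln (2::real) \<le> 25/36" "0 < ln (2::real)" using ln2_le_25_over_36 by auto
    have l2s: "(ln (2::real))\<^sup>2 \<le> (25/36)\<^sup>2" using l2 by (intro power_mono) auto
    have l3s: "(22/21)\<^sup>2 \<le> (ln (3::real))\<^sup>2" using ln3_ge by (intro power_mono) auto
    have "H2 x = P * (12 * (ln 2)\<^sup>2 + 4 * ln 2) - Q * ((8 - x) * (ln 3)\<^sup>2 + 2 * ln 3) - x * (2 * (ln 2)\<^sup>2 * P)"
      by (simp add: H2_def P_def Q_def algebra_simps)
    also have "\<dots> \<le> P * (12 * (ln 2)\<^sup>2 + 4 * ln 2) - Q * ((8 - x) * (ln 3)\<^sup>2 + 2 * ln 3)"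
      using x pos by simp
    also have "P * (12 * (ln 2)\<^sup>2 + 4 * ln 2) \<le> (59/50 * Q) * (12 * (25/36)\<^sup>2 + 4 * (25/36))"
      using PQ l2 l2s pos by (intro mult_mono add_mono) auto
    also have "(8 - 40/107) * (22/21)\<^sup>2 \<le> (8 - x) * (ln 3)\<^sup>2"
      using x l3s by (intro mult_mono) auto
    then have "Q * ((8 - 40/107) * (22/21)\<^sup>2 + 2 * (22/21)) \<le> Q * ((8 - x) * (ln 3)\<^sup>2 + 2 * ln 3)"
      using pos ln3_ge by (intro mult_left_mono) auto
    then have "(59/50 * Q) * (12 * (25/36)\<^sup>2 + 4 * (25/36)) - Q * ((8 - x) * (ln 3)\<^sup>2 + 2 * ln 3)
        \<le> (59/50 * Q) * (12 * (25/36)\<^sup>2 + 4 * (25/36)) - Q * ((8 - 40/107) * (22/21)\<^sup>2 + 2 * (22/21))"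
      by simp
    also have "\<dots> \<le> 0" using pos by (simp add: power2_eq_square)
    finally show "H2 x \<le> 0" by simp
  qed auto
  moreover have "0 < H (40 / 107)"
  proof -
    \<comment> \<open>Decimal values just below \<open>2 powr (-40/107)\<close> and
      \<open>3 powr (40/107)\<close>. The exponents 1, 3, 6, 13, 26, 53, 107 are the leading parts
      of the binary expansion of 107; the results are compared with \<open>2 ^ 40\<close> and
      \<open>3 ^ 40\<close>.\<close>
    define x y :: real where "x = 77173 / 100000" and "y = 1507866 / 1000000"
    have x: "0 \<le> x" "x \<le> 77173 / 100000" and y: "0 \<le> y" "y \<le> 1507866 / 1000000"
      by (simp_all add: x_def y_def)
    have x1: "x ^ 1 \<le> 77173 / 100000" and y1: "y ^ 1 \<le> 1507866 / 1000000" using x y by simp_all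
    have x3: "x ^ 3 \<le> 4596170698 / 10000000000" by (rule power_le_odd[OF x x1]) simp_all
    have x6: "x ^ 6 \<le> 2112478509 / 10000000000" by (rule power_le_even[OF x(1) x3]) simp_all
    have x13: "x ^ 13 \<le> 3443895636 / 100000000000" by (rule power_le_odd[OF x x6]) simp_all
    have x26: "x ^ 26 \<le> 1186041716 / 1000000000000" by (rule power_le_even[OF x(1) x13]) simp_all
    have x53: "x ^ 53 \<le> 1085588696 / 1000000000000000" by (rule power_le_odd[OF x x26]) simp_all
    have x107: "x ^ 107 \<le> 9094859789 / 10000000000000000000000" by (rule power_le_odd[OF x x53]) simp_all
    have "x \<le> (1/2) powr (real 40 / real 107)"
      by (rule le_powr_ratioI) (use x107 in \<open>simp_all add: power_divide\<close>)
    then have P: "77173 / 100000 \<le> (2::real) powr (- (40 / 107))"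
      by (simp add: x_def powr_divide powr_minus_divide)
    have y3: "y ^ 3 \<le> 3428374420 / 1000000000" by (rule power_le_odd[OF y y1]) simp_all
    have y6: "y ^ 6 \<le> 1175375117 / 100000000" by (rule power_le_even[OF y(1) y3]) simp_all
    have y13: "y ^ 13 \<le> 2083126930 / 10000000" by (rule power_le_odd[OF y y6]) simp_all
    have y26: "y ^ 26 \<le> 4339417807 / 100000" by (rule power_le_even[OF y(1) y13]) simp_all
    have y53: "y ^ 53 \<le> 2839394144" by (rule power_le_odd[OF y y26]) simp_all
    have y107: "y ^ 107 \<le> 12156655610000000000" by (rule power_le_odd[OF y y53]) simp_all
    have "y \<le> 3 powr (real 40 / real 107)"
      by (rule le_powr_ratioI) (use y107 in simp_all)
    then have "1507866 / 1000000 \<le> (3::real) powr (40 / 107)" by (simp add: y_def)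
    then have "(3::real) powr (- (40 / 107)) \<le> 1000000 / 1507866"
      by (simp add: powr_minus_divide field_simps)
    with P show ?thesis unfolding H_def by (simp add: algebra_simps)
  qed
  moreover have "H 0 = 0" by (simp add: H_def)
  define u where "u = a * (107 / 40)"
  have u: "0 < u" "u \<le> 1" "a = (1 - u) *\<^sub>R 0 + u *\<^sub>R (40 / 107)" using assms by (auto simp: u_def)
  ultimately have "(1 - u) * H 0 + u * H (40/107) \<le> H a"
    unfolding u(3) using u by (intro concave_onD[of "{0..40/107}" H]) auto
  moreover have "0 < u * H (40/107)" using \<open>0 < H (40/107)\<close> u(1) by simp
  ultimately have "0 < H a" using \<open>H 0 = 0\<close> by simp
  then show ?thesis by (simp add: H_def)
qed

text \<open>With the last step scaled to \<open>1\<close> and the preceding ones to \<open>r\<close> and \<open>q\<close>, the two functions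
  below are lower bounds for the differences of the last three weights; the step before \<open>q\<close>
  enters only through its being no shorter than \<open>q\<close>.\<close>
definition last_gap :: "real \<Rightarrow> real \<Rightarrow> real" where
  "last_gap \<alpha> r = 1 - ((1 + r) powr (1 - \<alpha>) - 1) / r + trap_defect \<alpha> 0 1 / r
     - trap_defect \<alpha> 1 (1 + r) / (2 * r\<^sup>2)"

definition second_last_gap :: "real \<Rightarrow> real \<Rightarrow> real \<Rightarrow> real" where
  "second_last_gap \<alpha> r q = ((1 + r) powr (1 - \<alpha>) - 1) / r
     - ((1 + r + q) powr (1 - \<alpha>) - (1 + r) powr (1 - \<alpha>)) / q
     + trap_defect \<alpha> 1 (1 + r) / (r * q) - trap_defect \<alpha> 0 1 / ((1 + r) * r)
     - trap_defect \<alpha> (1 + r) (1 + r + q) / (2 * q\<^sup>2)"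

section \<open>Positivity of the gaps on and near a uniform mesh\<close>

lemma powr_shift:
  fixes x :: real
  shows "0 < x \<Longrightarrow> x powr (1 - \<alpha>) = x * x powr (-\<alpha>)"
    and "0 < x \<Longrightarrow> x powr (2 - \<alpha>) = x\<^sup>2 * x powr (-\<alpha>)"
  using powr_add[of x 1 "-\<alpha>"] powr_add[of x 2 "-\<alpha>"] by auto

text \<open>Multiplied by \<open>2 - \<alpha>\<close> the gap becomes
  \<open>6 * (1 - P) - \<alpha> * (3 / 2 - P)\<close> with \<open>P = 2 powr (-\<alpha>)\<close>.
  Convexity puts \<open>P\<close> below the chord value \<open>1 - \<alpha> / 2\<close>, so the
  first term is at least \<open>3 * \<alpha>\<close>.\<close>

lemma last_gap_pos:
  assumes "0 < \<alpha>" "\<alpha> < 1"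
  shows "0 < last_gap \<alpha> 1"
proof -
  define P where "P = (2::real) powr (-\<alpha>)"
  have "2 powr ((1 - \<alpha>) *\<^sub>R 0 + \<alpha> *\<^sub>R (-1)) \<le> (1 - \<alpha>) * 2 powr (0::real) + \<alpha> * 2 powr (-1)"
  proof (rule convex_onD[where A = UNIV and f = "\<lambda>x. (2::real) powr x"])
    show "convex_on UNIV (\<lambda>x. (2::real) powr x)"
      by (rule f''_ge0_imp_convex[where f' = "\<lambda>x. ln 2 * 2 powr x" and f'' = "\<lambda>x. (ln 2)\<^sup>2 * 2 powr x"])
        (auto intro!: derivative_eq_intros simp: power2_eq_square)
  qed (use assms in auto)
  then have P: "P \<le> 1 - \<alpha> / 2" by (simp add: P_def powr_minus)
  have P0: "0 < P" by (simp add: P_def)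
  define c where "c = 1 / (2 - \<alpha>)"
  have c: "(2 - \<alpha>) * c = 1" "2 / (2 - \<alpha>) = 2 * c" using assms by (auto simp: c_def)
  have "last_gap \<alpha> 1 = 3 / 2 - P + (3 - 4 * P) * c"
    unfolding last_gap_def trap_defect_def c(2) by (simp add: powr_shift flip: P_def) (simp add: field_simps)
  then have "(2 - \<alpha>) * last_gap \<alpha> 1 = (2 - \<alpha>) * (3 / 2 - P) + (3 - 4 * P) * ((2 - \<alpha>) * c)"
    by (simp only:) (simp add: field_simps)
  also have "\<dots> = 6 * (1 - P) - \<alpha> * (3 / 2 - P)"
    unfolding c(1) by (simp add: field_simps)
  also have "\<dots> > 0"
  proof -
    have "0 < \<alpha> * P" using assms P0 by simp
    moreover have eq: "\<alpha> * (3 / 2 - P) = 3 / 2 * \<alpha> - \<alpha> * P" by (simp add: algebra_simps)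
    ultimately show ?thesis using assms P unfolding eq by argo
  qed
  finally show ?thesis using assms by (simp add: zero_less_mult_iff)
qed

text \<open>Up to the positive factor \<open>2 * (2 - \<alpha>) / 3\<close> this gap is the function
  of \<open>threshold_pos\<close>, whose range is reached because
  \<open>0.3738 < 40 / 107\<close>.\<close>

lemma second_last_gap_pos:
  assumes "0 < \<alpha>" "\<alpha> < 0.3738"
  shows "0 < second_last_gap \<alpha> 1 1"
proof -
  define P Q where "P = (2::real) powr (-\<alpha>)" and "Q = (3::real) powr (-\<alpha>)"
  define c where "c = 1 / (2 - \<alpha>)"
  have c: "(2 - \<alpha>) * c = 1" "2 / (2 - \<alpha>) = 2 * c" using assms by (auto simp: c_def)
  have "second_last_gap \<alpha> 1 1 = (12 * P - 3 - 9 * Q) * c + 3 * P - 3 / 2 - 3 / 2 * Q"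
    unfolding second_last_gap_def trap_defect_def c(2)
    by (simp add: powr_shift flip: P_def Q_def) (simp add: field_simps)
  then have "2 * (2 - \<alpha>) / 3 * second_last_gap \<alpha> 1 1
      = 2 / 3 * (12 * P - 3 - 9 * Q) * ((2 - \<alpha>) * c) + (2 - \<alpha>) * (2 * P - 1 - Q)"
    by (simp only:) (simp add: field_simps)
  also have "\<dots> = 12 * P - 8 * Q - 4 - \<alpha> * (2 * P - 1 - Q)"
    unfolding c(1) by (simp add: algebra_simps)
  also have "\<dots> > 0" using threshold_pos[of \<alpha>] assms by (simp add: P_def Q_def)
  finally show ?thesis using assms by (simp add: zero_less_mult_iff)
qed

text \<open>Both gaps are continuous and positive at ratio \<open>1\<close>, hence positive nearby.
  The ratio \<open>q\<close> may reach \<open>\<rho>\<^sup>2\<close> because it compares steps two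
  places apart.\<close>

lemma gaps_nonneg_near_one:
  assumes "0 < \<alpha>" "\<alpha> < 0.3738"
  obtains \<rho> where "1 < \<rho>" "\<rho> \<le> 1.02"
    "\<And>r. 1 \<le> r \<Longrightarrow> r \<le> \<rho> \<Longrightarrow> 0 \<le> last_gap \<alpha> r"
    "\<And>r q. 1 \<le> r \<Longrightarrow> r \<le> \<rho> \<Longrightarrow> 1 \<le> q \<Longrightarrow> q \<le> \<rho>\<^sup>2 \<Longrightarrow> 0 \<le> second_last_gap \<alpha> r q"
proof -
  have ev: "\<exists>e>0. \<forall>r q. \<bar>r - 1\<bar> < e \<longrightarrow> \<bar>q - 1\<bar> < e \<longrightarrow> 0 < f (r, q)"
    if f: "isCont f (1, 1)" "0 < f (1, 1)" for f :: "real \<times> real \<Rightarrow> real"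
  proof -
    have "eventually (\<lambda>z. 0 < f z) (nhds (1, 1))"
      using f by (intro order_tendstoD(1)[where y = "f (1, 1)"]) (auto simp: isCont_def tendsto_at_iff_tendsto_nhds)
    then obtain d where d: "0 < d" "\<And>z. dist z (1, 1) < d \<Longrightarrow> 0 < f z"
      by (auto simp: eventually_nhds_metric)
    have "0 < f (r, q)" if "\<bar>r - 1\<bar> < d / 2" "\<bar>q - 1\<bar> < d / 2" for r q
    proof (rule d(2))
      have "dist (r, q) (1, 1) \<le> \<bar>r - 1\<bar> + \<bar>q - 1\<bar>"
        by (simp add: dist_Pair_Pair dist_real_def sqrt_sum_squares_le_sum_abs)
      then show "dist (r, q) (1, 1) < d" using that by simp
    qed
    then show ?thesis using d(1) by (intro exI[of _ "d / 2"]) auto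
  qed
  have "isCont (\<lambda>z::real\<times>real. last_gap \<alpha> (fst z)) (1, 1)"
    unfolding last_gap_def trap_defect_def by (intro continuous_intros) auto
  from ev[OF this] obtain e1 where e1: "0 < e1" "\<And>r. \<bar>r - 1\<bar> < e1 \<Longrightarrow> 0 < last_gap \<alpha> r"
    using last_gap_pos[of \<alpha>] assms by force
  have "isCont (\<lambda>z::real\<times>real. second_last_gap \<alpha> (fst z) (snd z)) (1, 1)"
    unfolding second_last_gap_def trap_defect_def by (intro continuous_intros) auto
  from ev[OF this] obtain e2 where e2: "0 < e2"
    "\<And>r q. \<bar>r - 1\<bar> < e2 \<Longrightarrow> \<bar>q - 1\<bar> < e2 \<Longrightarrow> 0 < second_last_gap \<alpha> r q"
    using second_last_gap_pos[of \<alpha>] assms by force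
  \<comment> \<open>The division by \<open>3\<close> pays for the square, since
    \<open>(1 + m)\<^sup>2 < 1 + 3 * m\<close>. The cap \<open>0.06\<close> yields
    \<open>\<rho> \<le> 1.02\<close>, on which the numerical constants for the other weights
    rest.\<close>
  define m where "m = min (min e1 e2) 0.06 / 3"
  have m: "0 < m" "m \<le> 0.02" "m < e1" "3 * m \<le> e2" using e1(1) e2(1) by (auto simp: m_def)
  have "m * m < m * 1" using m by (intro mult_strict_left_mono) auto
  then have sq: "(1 + m)\<^sup>2 < 1 + 3 * m" by (simp add: power2_eq_square algebra_simps)
  show ?thesis
  proof (rule that[of "1 + m"])
    show "0 \<le> last_gap \<alpha> r" if "1 \<le> r" "r \<le> 1 + m" for r
      using that m e1(2)[of r] by force
    show "0 \<le> second_last_gap \<alpha> r q" if "1 \<le> r" "r \<le> 1 + m" "1 \<le> q" "q \<le> (1 + m)\<^sup>2" for r q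
      using that m sq e2(2)[of r q] by force
  qed (use m in auto)
qed

section \<open>Weights on graded meshes\<close>

text \<open>With \<open>s i = ln (t i)\<close>, the paper's \<open>a\<close> and \<open>b\<close> coefficients are \<open>slope_term\<close> times the step length
  and \<open>- corr_term\<close>. Setting \<open>corr_term\<close> to zero for \<open>i \<le> 1\<close> and \<open>i > k\<close> merges the four cases of
  the definition of \<open>c\<close> into one.\<close>
definition slope_term :: "real \<Rightarrow> (nat \<Rightarrow> real) \<Rightarrow> nat \<Rightarrow> nat \<Rightarrow> real" where
  "slope_term \<alpha> s i k =
     ((s k - s (i - 1)) powr (1 - \<alpha>) - (s k - s i) powr (1 - \<alpha>)) / (s i - s (i - 1))"

definition corr_term :: "real \<Rightarrow> (nat \<Rightarrow> real) \<Rightarrow> nat \<Rightarrow> nat \<Rightarrow> real" where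
  "corr_term \<alpha> s i k =
     (if i \<le> 1 \<or> k < i then 0 else trap_defect \<alpha> (s k - s i) (s k - s (i - 1)) / (s i - s (i - 2)))"

definition L12_weight :: "real \<Rightarrow> (nat \<Rightarrow> real) \<Rightarrow> nat \<Rightarrow> nat \<Rightarrow> real" where
  "L12_weight \<alpha> s i k =
     slope_term \<alpha> s i k + (corr_term \<alpha> s i k - corr_term \<alpha> s (i + 1) k) / (s i - s (i - 1))"

text \<open>The factor \<open>Gamma (2 - \<alpha>)\<close> is common to all coefficients, so order
  and lower bounds need only be studied for the weights.\<close>

lemma c_coef_eq_weight:
  assumes "1 \<le> i" "i \<le> k" and pos: "\<And>i. 0 < t i"
  shows "c_coef \<alpha> t i k = L12_weight \<alpha> (\<lambda>i. ln (t i)) i k / Gamma (2 - \<alpha>)"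
proof -
  have ln: "ln (t j / t i) = ln (t j) - ln (t i)" for i j
    using pos[of i] pos[of j] by (simp add: ln_div)
  have b: "b_coef \<alpha> t i k = - corr_term \<alpha> (\<lambda>i. ln (t i)) i k" if "2 \<le> i" "i \<le> k" for i
  proof -
    \<comment> \<open>The powers are replaced by free variables, which leaves an identity of
      rational expressions. The premise \<open>y - z = e\<close> says that a step is the difference
      of the distances of its ends to the current time.\<close>
    have "1 / D * (e * (u + v) + c * (U - V)) = - ((c * (V - U) - (y - z) * (u + v)) / D)"
      if "y - z = e" for D e u v c U V y z :: real
      unfolding that by (simp add: divide_inverse algebra_simps)
    from this[of "(ln (t k) - ln (t (i - 1)))" "ln (t k) - ln (t i)" "ln (t i) - ln (t (i - 1))"]
    show ?thesis
      using that by (simp only: b_coef_def corr_term_def trap_defect_def ln) auto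
  qed
  have a: "a_coef \<alpha> t i k = (ln (t k) - ln (t (i - 1))) powr (1 - \<alpha>) - (ln (t k) - ln (t i)) powr (1 - \<alpha>)"
    by (simp add: a_coef_def ln)
  consider "i = 1" "k = 1" | "i = 1" "2 \<le> k" | "2 \<le> i" "i = k" | "2 \<le> i" "i < k"
    using assms by linarith
  then show ?thesis
  proof cases
    case 1
    then show ?thesis
      using a by (simp add: c_coef_def L12_weight_def slope_term_def corr_term_def ln mult.commute)
  next
    case 2
    then show ?thesis
      using a b[of 2]
      by (simp add: c_coef_def L12_weight_def slope_term_def ln mult.commute corr_term_def[of _ _ "Suc 0"]
        numeral_2_eq_2 add_divide_distrib diff_divide_distrib)
  next
    case 3
    then show ?thesis
      using a b[of k]
      by (simp add: c_coef_def L12_weight_def slope_term_def ln mult.commute corr_term_def[of _ _ "Suc k"]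
        add_divide_distrib diff_divide_distrib)
  next
    case 4
    then show ?thesis
      using a b[of i] b[of "Suc i"]
      by (simp add: c_coef_def L12_weight_def slope_term_def ln mult.commute
        add_divide_distrib diff_divide_distrib)
  qed
qed

text \<open>Collects the properties of the logarithmic grid from which the weights are estimated.
  The mesh is an infinite sequence, so no final index has to be tracked; the two gap conditions fix
  how close to \<open>1\<close> the ratio bound \<open>\<rho>\<close> must be.\<close>

locale graded_mesh =
  fixes s :: "nat \<Rightarrow> real" and \<alpha> \<rho> :: real
  assumes alpha: "0 < \<alpha>" "\<alpha> < 0.3738"
    and rho: "1 < \<rho>" "\<rho> \<le> 1.02"
    and step_pos: "\<And>i. s i < s (Suc i)"
    and step_decr: "\<And>i. s (Suc (Suc i)) - s (Suc i) \<le> s (Suc i) - s i"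
    and step_ratio: "\<And>i. s (Suc i) - s i \<le> \<rho> * (s (Suc (Suc i)) - s (Suc i))"
    and last_gap: "\<And>r. 1 \<le> r \<Longrightarrow> r \<le> \<rho> \<Longrightarrow> 0 \<le> last_gap \<alpha> r"
    and second_last_gap: "\<And>r q. 1 \<le> r \<Longrightarrow> r \<le> \<rho> \<Longrightarrow> 1 \<le> q \<Longrightarrow> q \<le> \<rho>\<^sup>2 \<Longrightarrow>
      0 \<le> second_last_gap \<alpha> r q"
begin

section \<open>Bounds for the correction terms\<close>

lemma mono_s: "i \<le> j \<Longrightarrow> s i \<le> s j"
  by (rule lift_Suc_mono_le[of s]) (auto intro: less_imp_le step_pos)

lemma strict_mono_s: "i < j \<Longrightarrow> s i < s j"
  by (rule lift_Suc_mono_less[of s]) (auto intro: step_pos)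

lemma corr_nonneg: "0 \<le> corr_term \<alpha> s i k"
proof (cases "i \<le> 1 \<or> k < i")
  case False
  then have "0 \<le> trap_defect \<alpha> (s k - s i) (s k - s (i - 1))"
    using alpha mono_s[of i k] mono_s[of "i - 1" i] by (intro trap_defect_nonneg) auto
  moreover have "s (i - 2) < s i" using False by (intro strict_mono_s) auto
  ultimately show ?thesis by (simp add: corr_term_def)
qed (simp add: corr_term_def)

text \<open>As the steps decrease, two adjacent ones add up to at least twice the later one. The
  bound no longer contains the earlier step, and it also covers the first step, whose correction is
  \<open>0\<close> by convention.\<close>

lemma corr_le:
  "corr_term \<alpha> s (Suc i) k \<le> trap_defect \<alpha> (s k - s (Suc i)) (s k - s i) / (2 * (s (Suc i) - s i))"
  if "Suc i \<le> k"
proof -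
  have nn: "0 \<le> trap_defect \<alpha> (s k - s (Suc i)) (s k - s i)"
    using that alpha mono_s[of "Suc i" k] mono_s[of i "Suc i"] by (intro trap_defect_nonneg) auto
  show ?thesis
  proof (cases i)
    case 0
    then show ?thesis using nn step_pos[of 0] by (simp add: corr_term_def)
  next
    case (Suc j)
    have "2 * (s (Suc i) - s i) \<le> s (Suc i) - s j"
      using step_decr[of j] by (simp add: Suc)
    then show ?thesis
      using that nn step_pos[of i] by (simp add: corr_term_def Suc) (intro divide_left_mono mult_pos_pos, auto)
  qed
qed

lemma corr_le_far:
  assumes "Suc i < k"
  shows "corr_term \<alpha> s (Suc i) k \<le> \<alpha> * (1 - \<alpha>) * (s k - s (Suc i)) powr (-\<alpha> - 1) * (s (Suc i) - s i)\<^sup>2 / 12"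
proof -
  define d where "d = s (Suc i) - s i"
  have d: "0 < d" using step_pos by (simp add: d_def)
  have "corr_term \<alpha> s (Suc i) k \<le> trap_defect \<alpha> (s k - s (Suc i)) (s k - s i) / (2 * d)"
    using assms corr_le[of i k] by (simp add: d_def)
  also have "\<dots> \<le> (\<alpha> * (1 - \<alpha>) * (s k - s (Suc i)) powr (-\<alpha> - 1) * d ^ 3 / 6) / (2 * d)"
    using trap_defect_bounds_pos(2)[of \<alpha> "s k - s (Suc i)" "s k - s i"] alpha strict_mono_s[OF assms]
      step_pos[of i] d by (intro divide_right_mono) (auto simp: d_def)
  also have "\<dots> = \<alpha> * (1 - \<alpha>) * (s k - s (Suc i)) powr (-\<alpha> - 1) * d\<^sup>2 / 12"
    using d by (simp add: power2_eq_square power3_eq_cube)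
  finally show ?thesis by (simp add: d_def)
qed

text \<open>Because \<open>\<alpha> + 1 \<le> 3 / 2\<close>, a ratio of at most
  \<open>c\<^sup>2\<close> costs a factor of at most \<open>c ^ 3\<close>; writing the ratio as a
  square keeps this factor rational.\<close>

lemma powr_ratio_bound:
  fixes X Y c :: real
  assumes "0 < Y" "Y \<le> X" "X \<le> c\<^sup>2 * Y" "1 \<le> c"
  shows "Y powr (-\<alpha> - 1) \<le> c ^ 3 * X powr (-\<alpha> - 1)"
proof -
  have "(X / Y) powr (\<alpha> + 1) \<le> (c\<^sup>2) powr (\<alpha> + 1)"
    using assms alpha by (intro powr_mono2) (auto simp: field_simps)
  also have "\<dots> \<le> (c\<^sup>2) powr (3 / 2)"
    using assms alpha by (intro powr_mono) (auto simp: one_le_power)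
  also have "\<dots> = c ^ 3"
    using assms powr_powr[of c 2 "3/2"] powr_realpow[of c 2] powr_realpow[of c 3] by simp
  finally have "(X / Y) powr (\<alpha> + 1) * X powr (-\<alpha> - 1) \<le> c ^ 3 * X powr (-\<alpha> - 1)"
    by (intro mult_right_mono) auto
  moreover have "X powr (\<alpha> + 1) * X powr (-\<alpha> - 1) = 1"
    using assms by (simp flip: powr_add)
  then have "(X / Y) powr (\<alpha> + 1) * X powr (-\<alpha> - 1) = Y powr (-\<alpha> - 1)"
    using assms powr_minus_divide[of Y "\<alpha> + 1"] by (simp add: powr_divide)
  ultimately show ?thesis by simp
qed

section \<open>Monotonicity of the weights and the size of the first one\<close>

lemma weight_mono_far:
  assumes k: "j + 4 \<le> k"
  shows "L12_weight \<alpha> s (Suc j) k \<le> L12_weight \<alpha> s (Suc (Suc j)) k"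
proof -
  define d1 d2 d3 d4 where "d1 = s (Suc j) - s j" and "d2 = s (Suc (Suc j)) - s (Suc j)"
    and "d3 = s (Suc (Suc (Suc j))) - s (Suc (Suc j))"
    and "d4 = s (Suc (Suc (Suc (Suc j)))) - s (Suc (Suc (Suc j)))"
  have d: "0 < d1" "0 < d2" "0 < d3" "0 < d4" "d2 \<le> d1" "d3 \<le> d2" "d1 \<le> \<rho> * d2" "d2 \<le> \<rho> * d3" "d3 \<le> \<rho> * d4"
    using step_pos step_decr step_ratio by (auto simp: d1_def d2_def d3_def d4_def)
  have \<rho>: "\<rho> * x \<le> 1.02 * x" if "0 < x" for x using rho that by (intro mult_right_mono) auto
  have dr: "d1 \<le> 1.02 * d2" "d2 \<le> 1.02 * d3" "d3 \<le> 1.02 * d4"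
    using d \<rho>[of d2] \<rho>[of d3] \<rho>[of d4] by linarith+
  define Y where "Y = s k - s (Suc (Suc (Suc j)))"
  define Z where "Z = s k - s (Suc j)"
  define X where "X = s k - s j"
  have "s (Suc (Suc (Suc (Suc j)))) \<le> s k" using k by (intro mono_s) simp
  then have Y: "d4 \<le> Y" "0 < Y" using d by (auto simp: Y_def d4_def)
  have ZX: "Z = Y + d3 + d2" "X = Y + d3 + d2 + d1" by (auto simp: X_def Y_def Z_def d1_def d2_def d3_def)
  define K where "K = \<alpha> * (1 - \<alpha>) * X powr (-\<alpha> - 1)"
  have K: "0 \<le> K" using alpha by (simp add: K_def)
  \<comment> \<open>With ratios at most \<open>1.02\<close> one has \<open>X \<le> 4.13 * Y\<close>
    and \<open>X \<le> 1.35 * Z\<close>, and \<open>2.1\<^sup>2 = 4.41\<close>,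
    \<open>1.2\<^sup>2 = 1.44\<close>. The first estimate uses that a whole step \<open>d4\<close>
    fits into \<open>Y\<close>, which is why \<open>j + 4 \<le> k\<close> is required.\<close>
  have Yp: "Y powr (-\<alpha> - 1) \<le> 2.1 ^ 3 * X powr (-\<alpha> - 1)"
    using Y d dr by (intro powr_ratio_bound) (auto simp: ZX power2_eq_square)
  have Zp: "Z powr (-\<alpha> - 1) \<le> 1.2 ^ 3 * X powr (-\<alpha> - 1)"
    using Y d dr by (intro powr_ratio_bound) (auto simp: ZX power2_eq_square)
  have aa: "0 \<le> \<alpha> * (1 - \<alpha>)" using alpha by simp
  have "corr_term \<alpha> s (Suc (Suc (Suc j))) k \<le> \<alpha> * (1 - \<alpha>) * Y powr (-\<alpha> - 1) * d3\<^sup>2 / 12"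
    using corr_le_far[of "Suc (Suc j)" k] k by (simp add: Y_def d3_def)
  also have "\<dots> \<le> \<alpha> * (1 - \<alpha>) * (2.1 ^ 3 * X powr (-\<alpha> - 1)) * (d2 * d2) / 12"
    using Yp d aa alpha unfolding power2_eq_square by (intro divide_right_mono mult_mono) auto
  finally have "corr_term \<alpha> s (Suc (Suc (Suc j))) k / d2 \<le> (2.1 ^ 3 * K * (d2 * d2) / 12) / d2"
    using d by (intro divide_right_mono) (auto simp: K_def mult_ac)
  then have b3: "corr_term \<alpha> s (Suc (Suc (Suc j))) k / d2 \<le> 2.1 ^ 3 * K * d2 / 12" using d by simp
  have "corr_term \<alpha> s (Suc j) k \<le> \<alpha> * (1 - \<alpha>) * Z powr (-\<alpha> - 1) * d1\<^sup>2 / 12"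
    using corr_le_far[of j k] k by (simp add: Z_def d1_def)
  also have "\<dots> \<le> \<alpha> * (1 - \<alpha>) * (1.2 ^ 3 * X powr (-\<alpha> - 1)) * (1.02 * d2 * d1) / 12"
    using Zp d dr aa alpha unfolding power2_eq_square by (intro divide_right_mono mult_mono) auto
  finally have "corr_term \<alpha> s (Suc j) k / d1 \<le> (1.2 ^ 3 * K * (1.02 * d2 * d1) / 12) / d1"
    using d by (intro divide_right_mono) (auto simp: K_def mult_ac)
  then have b1: "corr_term \<alpha> s (Suc j) k / d1 \<le> 1.2 ^ 3 * K * (1.02 * d2) / 12" using d by simp
  \<comment> \<open>The gain in slope. Both occurrences of the middle correction help and are
    dropped; the two outer ones cost at most about \<open>0.15 * d2 * K\<close> and
    \<open>0.78 * d2 * K\<close>, less than the gain together.\<close>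
  have "d2 * K \<le> slope_term \<alpha> s (Suc (Suc j)) k - slope_term \<alpha> s (Suc j) k"
    using powr_slope_diff[of \<alpha> "s k - s (Suc (Suc j))" "s k - s (Suc j)" "s k - s j"]
      alpha step_pos[of j] step_pos[of "Suc j"] step_decr[of j] Y d
    by (simp add: slope_term_def K_def X_def d2_def Y_def d3_def)
  moreover have "0 \<le> corr_term \<alpha> s (Suc (Suc j)) k / d2" "0 \<le> corr_term \<alpha> s (Suc (Suc j)) k / d1"
    using corr_nonneg d by simp_all
  moreover have "1.2 ^ 3 * K * (1.02 * d2) / 12 + 2.1 ^ 3 * K * d2 / 12 \<le> d2 * K"
    using mult_nonneg_nonneg[OF K less_imp_le[OF d(2)]] by (simp add: power3_eq_cube mult_ac)
  ultimately show ?thesis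
    using b1 b3 by (simp add: L12_weight_def diff_divide_distrib flip: d1_def d2_def)
qed

text \<open>After division by the last step \<open>w\<close> and by
  \<open>w powr (-\<alpha>)\<close> the difference of the weights is at least
  \<open>second_last_gap \<alpha> r q\<close>. The ratio \<open>q\<close> is a product of two
  adjacent ratios, hence at most \<open>\<rho>\<^sup>2\<close>.\<close>

lemma weight_mono_second_last:
  assumes k: "k = Suc (Suc (Suc j))"
  shows "L12_weight \<alpha> s (Suc j) k \<le> L12_weight \<alpha> s (Suc (Suc j)) k"
proof -
  define w where "w = s k - s (Suc (Suc j))"
  define r where "r = (s (Suc (Suc j)) - s (Suc j)) / w"
  define q where "q = (s (Suc j) - s j) / w"
  have w: "0 < w" using step_pos by (simp add: w_def k)
  have d1: "s (Suc (Suc j)) - s (Suc j) = w * r" and d2: "s (Suc j) - s j = w * q"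
    using w by (simp_all add: r_def q_def)
  have rel: "w \<le> w * r" "w * r \<le> \<rho> * w" "w * r \<le> w * q" "w * q \<le> \<rho> * (w * r)"
    unfolding d1[symmetric] d2[symmetric] unfolding w_def k by (rule step_decr step_ratio)+
  then have r: "1 \<le> r" "r \<le> \<rho>" "r \<le> q" "q \<le> \<rho> * r" using w by (auto simp: field_simps)
  have "\<rho> * r \<le> \<rho> * \<rho>" using r rho by (intro mult_left_mono) auto
  then have "q \<le> \<rho>\<^sup>2" using r unfolding power2_eq_square by linarith
  then have G: "0 \<le> second_last_gap \<alpha> r q" using r by (intro second_last_gap) auto
  have x: "s k - s k = w * 0" "s k - s (Suc (Suc j)) = w * 1" "s k - s (Suc j) = w * (1 + r)"
      "s k - s j = w * (1 + r + q)"
    using d1 d2 by (simp_all add: w_def algebra_simps)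
  have dd: "s (Suc (Suc j)) - s j = w * (r + q)" "s k - s (Suc j) = w * (1 + r)"
    using d1 d2 by (simp_all add: w_def algebra_simps)
  have rq: "0 < r" "0 < q" using r by auto
  define v where "v = w powr (-\<alpha>)"
  have v: "w powr (1 - \<alpha>) = w * v" "w powr (2 - \<alpha>) = w\<^sup>2 * v" "0 < v"
    using w by (simp_all add: powr_shift v_def)
  have E: "trap_defect \<alpha> (w * y) (w * z) = w\<^sup>2 * v * trap_defect \<alpha> y z" if "0 \<le> y" "0 \<le> z" for y z
    using trap_defect_scale[of w y z \<alpha>] that w v by simp
  have s2: "slope_term \<alpha> s (Suc (Suc j)) k = v * (((1 + r) powr (1 - \<alpha>) - 1) / r)"
    using w rq unfolding slope_term_def diff_Suc_1 x d1
    by (simp add: powr_mult v diff_divide_distrib right_diff_distrib)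
  have s1: "slope_term \<alpha> s (Suc j) k
      = v * (((1 + r + q) powr (1 - \<alpha>) - (1 + r) powr (1 - \<alpha>)) / q)"
    using w rq unfolding slope_term_def diff_Suc_1 x d2
    by (simp add: powr_mult v diff_divide_distrib right_diff_distrib)
  have "corr_term \<alpha> s k k = trap_defect \<alpha> (s k - s k) (s k - s (Suc (Suc j))) / (s k - s (Suc j))"
    by (simp add: corr_term_def k)
  then have "corr_term \<alpha> s k k = w\<^sup>2 * v * trap_defect \<alpha> 0 1 / (w * (1 + r))"
    unfolding x using E[of 0 1] by simp
  then have c3: "corr_term \<alpha> s k k / (w * r) = v * (trap_defect \<alpha> 0 1 / ((1 + r) * r))"
    using w rq by (simp add: power2_eq_square)
  have "corr_term \<alpha> s (Suc (Suc j)) k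
      = trap_defect \<alpha> (s k - s (Suc (Suc j))) (s k - s (Suc j)) / (s (Suc (Suc j)) - s j)"
    by (simp add: corr_term_def k)
  then have "corr_term \<alpha> s (Suc (Suc j)) k = w * (v * trap_defect \<alpha> 1 (1 + r) * (1 / (r + q)))"
    unfolding x dd using E[of 1 "1 + r"] rq w by (simp add: power2_eq_square)
  then have "corr_term \<alpha> s (Suc (Suc j)) k / (w * r) + corr_term \<alpha> s (Suc (Suc j)) k / (w * q)
      = v * trap_defect \<alpha> 1 (1 + r) * (1 / (r + q) * (1 / r + 1 / q))"
    using w by (simp only: mult_divide_mult_cancel_left) (simp add: algebra_simps)
  \<comment> \<open>The same correction enters both weights, and adding its two shares cancels the
    two-step length \<open>r + q\<close>.\<close>
  also have "1 / (r + q) * (1 / r + 1 / q) = 1 / (r * q)"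
    using rq by (simp add: divide_simps)
  finally have c2: "corr_term \<alpha> s (Suc (Suc j)) k / (w * r) + corr_term \<alpha> s (Suc (Suc j)) k / (w * q)
      = v * (trap_defect \<alpha> 1 (1 + r) / (r * q))" by simp
  \<comment> \<open>The step before \<open>q\<close>, if there is one, is not controlled by
    \<open>r\<close> and \<open>q\<close>, so this correction is bounded by \<open>corr_le\<close>
    instead of evaluated.\<close>
  have "corr_term \<alpha> s (Suc j) k \<le> w\<^sup>2 * v * trap_defect \<alpha> (1 + r) (1 + r + q) / (2 * (w * q))"
    using corr_le[of j k] unfolding x d2 using E[of "1 + r" "1 + r + q"] rq by (simp add: k)
  then have "corr_term \<alpha> s (Suc j) k / (w * q)
      \<le> w\<^sup>2 * v * trap_defect \<alpha> (1 + r) (1 + r + q) / (2 * (w * q)) / (w * q)"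
    using w rq by (intro divide_right_mono) auto
  also have "\<dots> = v * (trap_defect \<alpha> (1 + r) (1 + r + q) / (2 * q\<^sup>2))"
    using w rq by (simp add: power2_eq_square)
  finally have c1: "corr_term \<alpha> s (Suc j) k / (w * q) \<le> v * (trap_defect \<alpha> (1 + r) (1 + r + q) / (2 * q\<^sup>2))" .
  have "0 \<le> v * second_last_gap \<alpha> r q" using G v by simp
  then have "0 \<le> slope_term \<alpha> s (Suc (Suc j)) k - slope_term \<alpha> s (Suc j) k
      + (corr_term \<alpha> s (Suc (Suc j)) k / (w * r) + corr_term \<alpha> s (Suc (Suc j)) k / (w * q))
      - corr_term \<alpha> s k k / (w * r) - v * (trap_defect \<alpha> (1 + r) (1 + r + q) / (2 * q\<^sup>2))"
    unfolding s1 s2 c2 c3 second_last_gap_def by (simp only: right_diff_distrib distrib_left)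
  then show ?thesis
    using c1 unfolding L12_weight_def diff_Suc_1 d1 d2 by (simp add: diff_divide_distrib flip: k)
qed

text \<open>The same scaling as for the preceding difference, now leading to
  \<open>last_gap \<alpha> r\<close>. The correction at \<open>k\<close> is exact, and its two
  shares combine to the divisor \<open>r\<close>; the one before it is bounded by
  \<open>corr_le\<close>.\<close>

lemma weight_mono_last:
  assumes k: "k = Suc (Suc j)"
  shows "L12_weight \<alpha> s (Suc j) k \<le> L12_weight \<alpha> s k k"
proof -
  define w where "w = s k - s (Suc j)"
  define r where "r = (s (Suc j) - s j) / w"
  have w: "0 < w" using step_pos by (simp add: w_def k)
  have d1: "s (Suc j) - s j = w * r" using w by (simp add: r_def)
  have rel: "w \<le> w * r" "w * r \<le> \<rho> * w"
    unfolding d1[symmetric] unfolding w_def k by (rule step_decr step_ratio)+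
  then have r: "1 \<le> r" "r \<le> \<rho>" using w by (auto simp: field_simps)
  then have G: "0 \<le> last_gap \<alpha> r" by (intro last_gap)
  have x: "s k - s k = w * 0" "s k - s (Suc j) = w * 1" "s k - s j = w * (1 + r)"
    using d1 by (simp_all add: w_def algebra_simps)
  have rq: "0 < r" using r by auto
  define v where "v = w powr (-\<alpha>)"
  have v: "w powr (1 - \<alpha>) = w * v" "w powr (2 - \<alpha>) = w\<^sup>2 * v" "0 < v"
    using w by (simp_all add: powr_shift v_def)
  have E: "trap_defect \<alpha> (w * y) (w * z) = w\<^sup>2 * v * trap_defect \<alpha> y z" if "0 \<le> y" "0 \<le> z" for y z
    using trap_defect_scale[of w y z \<alpha>] that w v by simp
  have "slope_term \<alpha> s k k = ((s k - s (Suc j)) powr (1 - \<alpha>) - (s k - s k) powr (1 - \<alpha>)) / (s k - s (Suc j))"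
    by (simp add: slope_term_def k)
  then have s2: "slope_term \<alpha> s k k = v" unfolding x using w by (simp add: v)
  have s1: "slope_term \<alpha> s (Suc j) k = v * (((1 + r) powr (1 - \<alpha>) - 1) / r)"
    using w rq unfolding slope_term_def diff_Suc_1 x d1
    by (simp add: powr_mult v diff_divide_distrib right_diff_distrib)
  have "corr_term \<alpha> s k k = trap_defect \<alpha> (s k - s k) (s k - s (Suc j)) / (s k - s j)"
    by (simp add: corr_term_def k)
  then have c: "corr_term \<alpha> s k k = w * (v * trap_defect \<alpha> 0 1 * (1 / (1 + r)))"
    unfolding x using E[of 0 1] w by (simp add: power2_eq_square)
  have "w * T / w + w * T / (w * r) = T * (1 + 1 / r)" for T
    using w by (simp add: distrib_left)
  from this[of "v * trap_defect \<alpha> 0 1 * (1 / (1 + r))"]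
  have "corr_term \<alpha> s k k / w + corr_term \<alpha> s k k / (w * r)
      = v * trap_defect \<alpha> 0 1 * (1 / (1 + r) * (1 + 1 / r))"
    unfolding c by (simp only: mult.assoc)
  also have "1 / (1 + r) * (1 + 1 / r) = 1 / r"
    using rq by (simp add: divide_simps)
  finally have c2: "corr_term \<alpha> s k k / w + corr_term \<alpha> s k k / (w * r) = v * (trap_defect \<alpha> 0 1 / r)" by simp
  have "corr_term \<alpha> s (Suc j) k \<le> w\<^sup>2 * v * trap_defect \<alpha> 1 (1 + r) / (2 * (w * r))"
    using corr_le[of j k] unfolding x d1 using E[of 1 "1 + r"] rq by (simp add: k)
  then have "corr_term \<alpha> s (Suc j) k / (w * r) \<le> w\<^sup>2 * v * trap_defect \<alpha> 1 (1 + r) / (2 * (w * r)) / (w * r)"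
    using w rq by (intro divide_right_mono) auto
  also have "\<dots> = v * (trap_defect \<alpha> 1 (1 + r) / (2 * r\<^sup>2))"
    using w rq by (simp add: power2_eq_square)
  finally have c1: "corr_term \<alpha> s (Suc j) k / (w * r) \<le> v * (trap_defect \<alpha> 1 (1 + r) / (2 * r\<^sup>2))" .
  have "0 \<le> v * last_gap \<alpha> r" using G v by simp
  then have "0 \<le> slope_term \<alpha> s k k - slope_term \<alpha> s (Suc j) k
      + (corr_term \<alpha> s k k / w + corr_term \<alpha> s k k / (w * r))
      - v * (trap_defect \<alpha> 1 (1 + r) / (2 * r\<^sup>2))"
    unfolding s1 s2 c2 last_gap_def by (simp only: right_diff_distrib distrib_left mult_1_right)
  moreover have "corr_term \<alpha> s (Suc k) k = 0" by (simp add: corr_term_def)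
  moreover have "s k - s (k - 1) = w" by (simp add: w_def k)
  ultimately show ?thesis
    using c1 unfolding L12_weight_def diff_Suc_1 d1 by (simp add: diff_divide_distrib flip: k)
qed

lemma weight_mono:
  assumes "1 \<le> i" "i < k"
  shows "L12_weight \<alpha> s i k \<le> L12_weight \<alpha> s (i + 1) k"
proof -
  obtain j where j: "i = Suc j" using assms by (cases i) auto
  consider "k = Suc (Suc j)" | "k = Suc (Suc (Suc j))" | "j + 4 \<le> k" using assms j by linarith
  then show ?thesis
    using weight_mono_last[of k j] weight_mono_second_last[of k j] weight_mono_far[of j k] j by cases auto
qed

text \<open>The slope over the first step is at least \<open>R\<close>, the derivative of
  \<open>y powr (1 - \<alpha>)\<close> at the far end \<open>X\<close>, and the correction removes
  at most \<open>5 / 6\<close> of \<open>R\<close>. The remaining sixth becomes the factor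
  \<open>6\<close> in the stability constant.\<close>

lemma weight_first_ge:
  assumes "1 \<le> k"
  shows "(1 - \<alpha>) * (s k - s 0) powr (-\<alpha>) / 6 \<le> L12_weight \<alpha> s 1 k"
proof -
  define X where "X = s k - s 0"
  define d1 where "d1 = s 1 - s 0"
  have d1: "0 < d1" using step_pos[of 0] by (simp add: d1_def)
  have dX: "d1 \<le> X" using mono_s[of 1 k] assms by (simp add: X_def d1_def)
  define R where "R = (1 - \<alpha>) * X powr (-\<alpha>)"
  have R: "0 < R" using alpha d1 dX by (simp add: R_def)
  have sl: "slope_term \<alpha> s 1 k = (X powr (1 - \<alpha>) - (X - d1) powr (1 - \<alpha>)) / d1"
    by (simp add: slope_term_def X_def d1_def)
  have slope: "R \<le> slope_term \<alpha> s 1 k"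
  proof (cases "X = d1")
    case True
    have "slope_term \<alpha> s 1 k = X powr (-\<alpha>)" 
      unfolding sl using True d1 by (simp add: powr_shift)
    then show ?thesis using alpha by (simp add: R_def mult_left_le_one_le)
  next
    case False
    then have lt: "0 < X - d1" using dX by simp
    have der: "((\<lambda>y. y powr (1 - \<alpha>)) has_real_derivative (1 - \<alpha>) * y powr (-\<alpha>)) (at y)" if "X - d1 \<le> y" for y
      using that lt by (auto intro!: derivative_eq_intros)
    obtain y where y: "X - d1 < y" "y < X"
      "X powr (1 - \<alpha>) - (X - d1) powr (1 - \<alpha>) = (X - (X - d1)) * ((1 - \<alpha>) * y powr (-\<alpha>))"
      using MVT2[of "X - d1" X "\<lambda>y. y powr (1 - \<alpha>)" "\<lambda>y. (1 - \<alpha>) * y powr (-\<alpha>)"] der d1 by auto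
    have "X powr (-\<alpha>) \<le> y powr (-\<alpha>)" using y lt alpha by (intro powr_mono2') auto
    moreover have "slope_term \<alpha> s 1 k = (1 - \<alpha>) * y powr (-\<alpha>)"
      unfolding sl using y(3) d1 by simp
    ultimately show ?thesis using alpha by (simp add: R_def)
  qed
  have "corr_term \<alpha> s 2 k / d1 \<le> 5 / 6 * R"
  proof -
    define d2 where "d2 = s 2 - s 1"
    have d2: "0 < d2" "d2 \<le> d1" "d1 \<le> 1.02 * d2"
    proof -
      show "0 < d2" "d2 \<le> d1" using step_pos[of 1] step_decr[of 0] by (simp_all add: d2_def d1_def numeral_2_eq_2)
      have "d1 \<le> \<rho> * d2" using step_ratio[of 0] by (simp add: d2_def d1_def numeral_2_eq_2)
      also have "\<dots> \<le> 1.02 * d2" using rho \<open>0 < d2\<close> by (intro mult_right_mono) auto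
      finally show "d1 \<le> 1.02 * d2" .
    qed
    consider "k = 1" | "k = 2" | "3 \<le> k" using assms by linarith
    then show ?thesis
    proof cases
      case 1
      then show ?thesis using R by (simp add: corr_term_def)
    next
      case 2
      have X2: "X = d1 + d2" using 2 by (simp add: X_def d1_def d2_def)
      have "corr_term \<alpha> s (Suc 1) k \<le> trap_defect \<alpha> (s k - s (Suc 1)) (s k - s 1) / (2 * (s (Suc 1) - s 1))"
        using 2 by (intro corr_le) simp
      then have "corr_term \<alpha> s 2 k \<le> trap_defect \<alpha> 0 d2 / (2 * d2)"
        using 2 by (simp add: d2_def numeral_2_eq_2)
      also have "\<dots> = \<alpha> / (2 - \<alpha>) / 2 * (d2 * d2 powr (-\<alpha>))"
        using d2 alpha by (simp add: trap_defect_zero_left powr_shift power2_eq_square)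
      also have "\<dots> \<le> \<alpha> / (2 - \<alpha>) / 2 * (d1 * d2 powr (-\<alpha>))"
        using d2 alpha by (intro mult_mono) auto
      finally have "corr_term \<alpha> s 2 k / d1 \<le> \<alpha> / (2 - \<alpha>) / 2 * (d1 * d2 powr (-\<alpha>)) / d1"
        using d1 by (intro divide_right_mono) auto
      then have 1: "corr_term \<alpha> s 2 k / d1 \<le> \<alpha> / (2 - \<alpha>) / 2 * d2 powr (-\<alpha>)" using d1 by simp
      \<comment> \<open>Generous rounding: \<open>X = d1 + d2\<close> is at most
        \<open>3 * d2\<close>, and \<open>3 powr \<alpha>\<close> at most \<open>3\<close>.\<close>
      have "d2 powr (-\<alpha>) = 3 powr \<alpha> * (3 * d2) powr (-\<alpha>)"
        using d2 by (simp add: powr_mult powr_minus)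
      also have "\<dots> \<le> 3 powr 1 * X powr (-\<alpha>)"
        using d2 alpha by (intro mult_mono powr_mono powr_mono2') (auto simp: X2)
      finally have 2: "d2 powr (-\<alpha>) \<le> 3 * X powr (-\<alpha>)" by simp
      have "\<alpha> / (2 - \<alpha>) / 2 * 3 \<le> 5 / 6 * (1 - \<alpha>)"
      proof -
        have "\<alpha> / (2 - \<alpha>) \<le> 1 / 4" using alpha by (simp add: field_simps)
        then have "\<alpha> / (2 - \<alpha>) / 2 * 3 \<le> 1 / 4 / 2 * 3" by (intro mult_right_mono divide_right_mono) auto
        also have "\<dots> \<le> 5 / 6 * (1 - \<alpha>)" using alpha by simp
        finally show ?thesis .
      qed
      then have "\<alpha> / (2 - \<alpha>) / 2 * 3 * X powr (-\<alpha>) \<le> 5 / 6 * (1 - \<alpha>) * X powr (-\<alpha>)"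
        by (intro mult_right_mono) auto
      moreover have "\<alpha> / (2 - \<alpha>) / 2 * d2 powr (-\<alpha>) \<le> \<alpha> / (2 - \<alpha>) / 2 * (3 * X powr (-\<alpha>))"
        using 2 alpha by (intro mult_left_mono) auto
      ultimately have "\<alpha> / (2 - \<alpha>) / 2 * d2 powr (-\<alpha>) \<le> 5 / 6 * R"
        unfolding R_def mult.assoc by (rule order_trans[rotated])
      with 1 show ?thesis by (rule order_trans)
    next
      case 3
      define Y where "Y = s k - s 2"
      have s3: "s 3 \<le> s k" using 3 by (intro mono_s)
      have "d2 \<le> \<rho> * (s 3 - s 2)" using step_ratio[of 1] by (simp add: d2_def numeral_2_eq_2 numeral_3_eq_3)
      also have "\<dots> \<le> 1.02 * (s 3 - s 2)" using rho step_pos[of 2] by (intro mult_right_mono) (auto simp: numeral_3_eq_3 numeral_2_eq_2)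
      also have "\<dots> \<le> 1.02 * Y" using s3 by (simp add: Y_def)
      finally have Y: "d2 \<le> 1.02 * Y" "0 < Y" using d2 by auto
      have XY: "X = Y + d2 + d1" by (simp add: X_def Y_def d1_def d2_def)
      have "corr_term \<alpha> s 2 k \<le> \<alpha> * (1 - \<alpha>) * Y powr (-\<alpha> - 1) * d2\<^sup>2 / 12"
        using corr_le_far[of 1 k] 3 by (simp add: Y_def d2_def numeral_2_eq_2)
      \<comment> \<open>Here \<open>X \<le> 3.07 * Y\<close>, well below
        \<open>2.1\<^sup>2 * Y\<close>, and \<open>2.1 ^ 3 / 12 < 5 / 6\<close>.\<close>
      also have "Y powr (-\<alpha> - 1) \<le> 2.1 ^ 3 * X powr (-\<alpha> - 1)"
        using Y d2 d1 by (intro powr_ratio_bound) (auto simp: XY power2_eq_square)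
      then have "\<alpha> * (1 - \<alpha>) * Y powr (-\<alpha> - 1) * d2\<^sup>2 / 12
          \<le> 1 * (1 - \<alpha>) * (2.1 ^ 3 * X powr (-\<alpha> - 1)) * (X * d1) / 12"
        using alpha d2 d1 dX unfolding power2_eq_square by (intro divide_right_mono mult_mono) auto
      also have "\<dots> = 2.1 ^ 3 / 12 * R * d1"
        using powr_mult_base[of X "-\<alpha> - 1"] d1 dX by (simp add: R_def mult_ac)
      finally have "corr_term \<alpha> s 2 k / d1 \<le> 2.1 ^ 3 / 12 * R"
        using d1 by (simp add: divide_le_eq)
      also have "\<dots> \<le> 5 / 6 * R" using R by (intro mult_right_mono) (auto simp: power3_eq_cube)
      finally show ?thesis .
    qed
  qed
  moreover have "corr_term \<alpha> s 1 k = 0" by (simp add: corr_term_def)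
  then have "L12_weight \<alpha> s 1 k = slope_term \<alpha> s 1 k - corr_term \<alpha> s 2 k / d1"
    by (simp add: L12_weight_def d1_def numeral_2_eq_2)
  ultimately show ?thesis using slope unfolding R_def X_def by linarith
qed

end

section \<open>Positivity of the discrete fractional Laplacian\<close>

lemma frac_coef_eq_cos:
  assumes "0 < \<beta>"
  shows "frac_coef \<beta> l m = integral (cbox (-pi, -pi) (pi, pi))
      (\<lambda>e. (4 * (sin (fst e / 2))\<^sup>2 + 4 * (sin (snd e / 2))\<^sup>2) powr (\<beta> / 2)
            * cos (fst e * l + snd e * m)) / (4 * pi\<^sup>2)"
proof -
  let ?c = "\<lambda>e::real\<times>real. complex_of_real ((4 * (sin (fst e / 2))\<^sup>2 + 4 * (sin (snd e / 2))\<^sup>2) powr (\<beta> / 2))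
                   * cis (- (fst e * real_of_int l + snd e * real_of_int m))"
  \<comment> \<open>The symbol vanishes at the origin, and \<open>0 < \<beta>\<close> keeps its
    power continuous there. Continuity gives the integrability needed to take the real part inside
    the integral.\<close>
  have "continuous_on (cbox (-pi, -pi) (pi, pi)) ?c"
    using assms by (auto intro!: continuous_intros continuous_on_powr')
  then have "?c integrable_on cbox (-pi, -pi) (pi, pi)" by (rule integrable_continuous)
  then have "Re (integral (cbox (-pi, -pi) (pi, pi)) ?c) = integral (cbox (-pi, -pi) (pi, pi)) (Re \<circ> ?c)"
    by (simp only: integral_linear[OF _ bounded_linear_Re])
  moreover have "Re \<circ> ?c = (\<lambda>e. (4 * (sin (fst e / 2))\<^sup>2 + 4 * (sin (snd e / 2))\<^sup>2) powr (\<beta> / 2)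
            * cos (fst e * l + snd e * m))"
  proof -
    have "cos (- a - b) = cos (a + b)" for a b :: real
      using cos_minus[of "a + b"] by simp
    then show ?thesis by (simp add: fun_eq_iff)
  qed
  ultimately show ?thesis
    by (simp add: frac_coef_def case_prod_beta')
qed

text \<open>Both sides are the squared modulus of the sum of
  \<open>w x * cis (\<theta> x)\<close>.\<close>

lemma sum_cos_diff_eq_squares:
  fixes w \<theta> :: "'a \<Rightarrow> real"
  assumes "finite A"
  shows "(\<Sum>x\<in>A. \<Sum>y\<in>A. cos (\<theta> y - \<theta> x) * (w y * w x))
    = (\<Sum>x\<in>A. w x * cos (\<theta> x))\<^sup>2 + (\<Sum>x\<in>A. w x * sin (\<theta> x))\<^sup>2"
proof -
  have "cos (\<theta> y - \<theta> x) * (w y * w x)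
      = (w x * cos (\<theta> x)) * (w y * cos (\<theta> y)) + (w x * sin (\<theta> x)) * (w y * sin (\<theta> y))" for x y
    by (simp add: cos_diff algebra_simps)
  then show ?thesis
    by (simp add: power2_eq_square sum_product sum.distrib)
qed

text \<open>Up to a nonnegative factor the quadratic form is the integral of the nonnegative symbol
  times the squared modulus of the Fourier sum of \<open>w\<close>.\<close>

lemma frac_lap_nonneg:
  assumes "0 < \<beta>"
  shows "0 \<le> (\<Sum>j\<in>{1..M-1}. \<Sum>k\<in>{1..M-1}. frac_lap \<beta> h M w j k * w j k)"
proof -
  define A where "A = {1..M-1} \<times> {1..M-1}"
  define W where "W = (\<lambda>x. w (fst x) (snd x))"
  define sy where "sy = (\<lambda>e::real\<times>real. (4 * (sin (fst e / 2))\<^sup>2 + 4 * (sin (snd e / 2))\<^sup>2) powr (\<beta> / 2))"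
  define \<theta> where "\<theta> = (\<lambda>e (x::nat\<times>nat). fst e * real (fst x) + snd e * real (snd x))"
  define Q where "Q = cbox (-pi, -pi) (pi, pi::real)"
  define co where "co = (\<lambda>x y. frac_coef \<beta> (int (fst y) - int (fst x)) (int (snd y) - int (snd x)))"
  have fA: "finite A" by (simp add: A_def)
  have co: "co x y = integral Q (\<lambda>e. sy e * cos (\<theta> e y - \<theta> e x)) / (4 * pi\<^sup>2)" for x y
    unfolding co_def frac_coef_eq_cos[OF assms] sy_def \<theta>_def Q_def by (simp add: algebra_simps)
  have int: "(\<lambda>e. sy e * cos (\<theta> e y - \<theta> e x) * v) integrable_on Q" for x y v
    unfolding Q_def sy_def \<theta>_def using assms
    by (intro integrable_continuous) (auto intro!: continuous_intros continuous_on_powr')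
  have "(\<Sum>x\<in>A. \<Sum>y\<in>A. co x y * (W y * W x))
      = (\<Sum>x\<in>A. \<Sum>y\<in>A. integral Q (\<lambda>e. sy e * cos (\<theta> e y - \<theta> e x) * (W y * W x))) / (4 * pi\<^sup>2)"
    by (simp add: co sum_divide_distrib)
  also have "(\<Sum>x\<in>A. \<Sum>y\<in>A. integral Q (\<lambda>e. sy e * cos (\<theta> e y - \<theta> e x) * (W y * W x)))
      = integral Q (\<lambda>e. \<Sum>x\<in>A. \<Sum>y\<in>A. sy e * cos (\<theta> e y - \<theta> e x) * (W y * W x))"
    using fA int by (simp add: integral_sum integrable_sum)
  also have "\<dots> = integral Q (\<lambda>e. sy e * ((\<Sum>x\<in>A. W x * cos (\<theta> e x))\<^sup>2 + (\<Sum>x\<in>A. W x * sin (\<theta> e x))\<^sup>2))"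
    by (simp add: sum_cos_diff_eq_squares[OF fA, symmetric] sum_distrib_left mult.assoc)
  also have "\<dots> / (4 * pi\<^sup>2) \<ge> 0"
    by (intro divide_nonneg_nonneg Henstock_Kurzweil_Integration.integral_nonneg)
      (auto simp: sy_def Q_def intro!: integrable_continuous continuous_intros continuous_on_powr' assms
        simp: \<theta>_def divide_pos_pos)
  finally have "0 \<le> (\<Sum>x\<in>A. \<Sum>y\<in>A. co x y * (W y * W x))" .
  then have "0 \<le> h powr (-\<beta>) * (\<Sum>x\<in>A. \<Sum>y\<in>A. co x y * (W y * W x))" by simp
  also have "\<dots> = (\<Sum>j\<in>{1..M-1}. \<Sum>k\<in>{1..M-1}. frac_lap \<beta> h M w j k * w j k)"
    by (simp add: A_def W_def co_def frac_lap_def sum.cartesian_product'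
      sum_distrib_left sum_distrib_right mult_ac)
  finally show ?thesis .
qed

section \<open>Stability\<close>

text \<open>The coefficients of the earlier values are nonnegative and telescope to
  \<open>c n n - c 1 n\<close>. The missing share \<open>c 1 n\<close> is supplied by
  \<open>x 0\<close> and by the bound on \<open>F n\<close>, so the bound \<open>x 0 + B\<close>
  reproduces itself.\<close>

lemma weighted_gronwall:
  fixes x F :: "nat \<Rightarrow> real" and c :: "nat \<Rightarrow> nat \<Rightarrow> real"
  assumes step: "\<And>n. 1 \<le> n \<Longrightarrow> n \<le> N \<Longrightarrow>
      c n n * x n \<le> (\<Sum>i\<in>{1..n-1}. (c (i + 1) n - c i n) * x i) + c 1 n * x 0 + F n"
    and mono: "\<And>i n. 1 \<le> i \<Longrightarrow> i < n \<Longrightarrow> n \<le> N \<Longrightarrow> c i n \<le> c (i + 1) n"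
    and pos: "\<And>n. 1 \<le> n \<Longrightarrow> n \<le> N \<Longrightarrow> 0 < c 1 n"
    and F: "\<And>n. 1 \<le> n \<Longrightarrow> n \<le> N \<Longrightarrow> F n \<le> c 1 n * B"
    and n: "1 \<le> n" "n \<le> N"
  shows "x n \<le> x 0 + B"
  using n
proof (induction n rule: less_induct)
  case (less n)
  have "(\<Sum>i\<in>{1..n-1}. (c (i + 1) n - c i n) * x i) \<le> (\<Sum>i\<in>{1..n-1}. (c (i + 1) n - c i n) * (x 0 + B))"
    using less mono by (intro sum_mono mult_left_mono) auto
  also have "\<dots> = (c n n - c 1 n) * (x 0 + B)"
  proof -
    have "(\<Sum>i\<in>{1..n-1}. c (i + 1) n - c i n) = c n n - c 1 n"
      using less.prems sum_Suc_diff[of 1 "n - 1" "\<lambda>i. c i n"] by simp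
    then show ?thesis by (simp only: sum_distrib_right[symmetric])
  qed
  finally have "c n n * x n \<le> (c n n - c 1 n) * (x 0 + B) + c 1 n * x 0 + c 1 n * B"
    using step[of n] F[of n] less.prems by linarith
  then have "c n n * x n \<le> c n n * (x 0 + B)" by (simp add: algebra_simps)
  moreover have "c 1 n \<le> c n n"
  proof -
    have "c 1 n \<le> c m n" if "1 \<le> m" "m \<le> n" for m
      using that
    proof (induction m rule: dec_induct)
      case (step m)
      then have "c 1 n \<le> c m n" by simp
      also have "c m n \<le> c (Suc m) n" using mono[of m n] step less.prems by simp
      finally show ?case .
    qed simp
    then show ?thesis using less.prems by simp
  qed
  then have "0 < c n n" using pos[of n] less.prems by simp
  ultimately show ?case by simp
qed

text \<open>The scheme is multiplied by \<open>U n\<close> and summed over the grid. The fractional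
  Laplacian contributes a nonnegative term, which is dropped; Cauchy-Schwarz bounds the rest, and
  one factor of the norm of \<open>U n\<close> is cancelled.\<close>

lemma L12_solution_energy_step:
  assumes sol: "L12_solution \<alpha> \<beta> a0 T L N M u0 f U" and "0 < \<beta>" "0 < L" "0 < M" "1 \<le> n" "n \<le> N"
    and c_def: "c = c_coef \<alpha> (tgrid a0 T N)" and h_def: "h = 2 * L / real M"
    and F_def: "F = (\<lambda>n j m. f (- L + real j * h) (- L + real m * h) (tgrid a0 T N n))"
    and mono: "\<And>i. 1 \<le> i \<Longrightarrow> i < n \<Longrightarrow> c i n \<le> c (i + 1) n" and pos: "0 < c 1 n"
  shows "c n n * l2h_norm h M (U n) \<le> (\<Sum>i\<in>{1..n-1}. (c (i + 1) n - c i n) * l2h_norm h M (U i))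
      + c 1 n * l2h_norm h M (U 0) + l2h_norm h M (F n)"
proof -
  define A where "A = {1..M-1} \<times> {1..M-1}"
  define flat where "flat = (\<lambda>(w::nat \<Rightarrow> nat \<Rightarrow> real) x. w (fst x) (snd x))"
  define nrm where "nrm = (\<lambda>w. L2_set (flat w) A)"
  define ip where "ip = (\<lambda>w v. \<Sum>x\<in>A. flat w x * flat v x)"
  have h: "0 < h" using assms by (simp add: h_def)
  have l2h: "l2h_norm h M w = h * nrm w" for w
    using h by (simp add: l2h_norm_def nrm_def L2_set_def flat_def A_def real_sqrt_mult
      sum.cartesian_product case_prod_beta)
  have cs: "ip w v \<le> nrm w * nrm v" for w v
  proof -
    have "ip w v \<le> (\<Sum>x\<in>A. \<bar>flat w x\<bar> * \<bar>flat v x\<bar>)"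
      unfolding ip_def by (intro sum_mono) (metis abs_ge_self abs_mult)
    also have "\<dots> \<le> nrm w * nrm v" unfolding nrm_def by (rule L2_set_mult_ineq)
    finally show ?thesis .
  qed
  have nn: "0 \<le> nrm w" for w by (simp add: nrm_def)
  have sq: "ip w w = nrm w * nrm w" for w
    by (simp add: ip_def nrm_def L2_set_def sum_nonneg flip: power2_eq_square)
  have frac: "0 \<le> ip (frac_lap \<beta> h M (U n)) (U n)"
    using frac_lap_nonneg[OF \<open>0 < \<beta>\<close>, where M = M and h = h and w = "U n"]
    by (simp add: ip_def A_def flat_def sum.cartesian_product case_prod_beta)
  have eq: "c n n * flat (U n) x + (\<Sum>i\<in>{1..n-1}. (c i n - c (i + 1) n) * flat (U i) x)
      - c 1 n * flat (U 0) x + flat (frac_lap \<beta> h M (U n)) x = flat (F n) x" if "x \<in> A" for x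
  \<comment> \<open>The scheme states its first step separately; it is the general equation with an
    empty sum.\<close>
  proof (cases "n = 1")
    case True
    then show ?thesis
      using sol that unfolding L12_solution_def Let_def A_def flat_def F_def c_def h_def by auto
  next
    case False
    then have "n \<in> {2..N}" using assms by auto
    then show ?thesis
      using sol that unfolding L12_solution_def Let_def A_def flat_def F_def c_def h_def by (auto simp del: One_nat_def)
  qed
  have "ip (F n) (U n) = (\<Sum>x\<in>A. (c n n * flat (U n) x + (\<Sum>i\<in>{1..n-1}. (c i n - c (i + 1) n) * flat (U i) x)
      - c 1 n * flat (U 0) x + flat (frac_lap \<beta> h M (U n)) x) * flat (U n) x)"
    unfolding ip_def by (intro sum.cong refl) (simp only: eq)
  also have "\<dots> = c n n * ip (U n) (U n) + (\<Sum>x\<in>A. \<Sum>i\<in>{1..n-1}. (c i n - c (i + 1) n) * (flat (U i) x * flat (U n) x))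
      - c 1 n * ip (U 0) (U n) + ip (frac_lap \<beta> h M (U n)) (U n)"
    by (simp add: ip_def distrib_right left_diff_distrib sum.distrib sum_subtractf sum_distrib_left
      sum_distrib_right mult.assoc)
  also have "(\<Sum>x\<in>A. \<Sum>i\<in>{1..n-1}. (c i n - c (i + 1) n) * (flat (U i) x * flat (U n) x))
      = - (\<Sum>i\<in>{1..n-1}. (c (i + 1) n - c i n) * ip (U i) (U n))"
    by (subst sum.swap) (simp add: ip_def sum_distrib_left left_diff_distrib flip: sum_negf)
  finally have "c n n * ip (U n) (U n) \<le> (\<Sum>i\<in>{1..n-1}. (c (i + 1) n - c i n) * ip (U i) (U n))
      + c 1 n * ip (U 0) (U n) + ip (F n) (U n)" using frac by simp
  also have "(\<Sum>i\<in>{1..n-1}. (c (i + 1) n - c i n) * ip (U i) (U n))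
      \<le> (\<Sum>i\<in>{1..n-1}. (c (i + 1) n - c i n) * (nrm (U i) * nrm (U n)))"
    using mono cs assms(5) by (intro sum_mono mult_left_mono) auto
  also have "c 1 n * ip (U 0) (U n) \<le> c 1 n * (nrm (U 0) * nrm (U n))"
    using pos cs by (intro mult_left_mono) auto
  also have "ip (F n) (U n) \<le> nrm (F n) * nrm (U n)" by (rule cs)
  finally have main: "(c n n * nrm (U n)) * nrm (U n)
      \<le> ((\<Sum>i\<in>{1..n-1}. (c (i + 1) n - c i n) * nrm (U i)) + c 1 n * nrm (U 0) + nrm (F n)) * nrm (U n)"
    by (simp add: sq distrib_right sum_distrib_right mult.assoc)
  have rhs: "0 \<le> (\<Sum>i\<in>{1..n-1}. (c (i + 1) n - c i n) * nrm (U i)) + c 1 n * nrm (U 0) + nrm (F n)"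
    using mono pos nn assms(5) by (intro add_nonneg_nonneg sum_nonneg mult_nonneg_nonneg) auto
  have "c n n * nrm (U n) \<le> (\<Sum>i\<in>{1..n-1}. (c (i + 1) n - c i n) * nrm (U i)) + c 1 n * nrm (U 0) + nrm (F n)"
  proof (cases "nrm (U n) = 0")
    case True
    then show ?thesis using rhs by simp
  next
    case False
    then have "0 < nrm (U n)" using nn[of "U n"] by simp
    then show ?thesis using main by (simp only: mult_le_cancel_right_pos)
  qed
  then have "h * (c n n * nrm (U n)) \<le> h * ((\<Sum>i\<in>{1..n-1}. (c (i + 1) n - c i n) * nrm (U i)) + c 1 n * nrm (U 0) + nrm (F n))"
    using h by (intro mult_left_mono) auto
  then show ?thesis by (simp add: l2h distrib_left sum_distrib_left mult.left_commute)
qed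

text \<open>The step from \<open>t i\<close> has length \<open>ln (1 + \<tau> / t i)\<close>, which
  decreases in \<open>i\<close> and lies between \<open>\<tau> / t (Suc i)\<close> and
  \<open>\<tau> / t i\<close>. Adjacent steps therefore have ratio at most
  \<open>t (i + 2) / t i = 1 + 2 * \<tau> / t i\<close>, and \<open>t i \<ge> a0\<close>.\<close>

lemma log_grid_graded_mesh:
  fixes \<alpha> \<rho> a0 T :: real
  assumes "0 < \<alpha>" "\<alpha> < 0.3738" "0 < a0" "a0 < T" "0 < N"
    and rho: "1 < \<rho>" "\<rho> \<le> 1.02"
    and gaps: "\<And>r. 1 \<le> r \<Longrightarrow> r \<le> \<rho> \<Longrightarrow> 0 \<le> last_gap \<alpha> r"
      "\<And>r q. 1 \<le> r \<Longrightarrow> r \<le> \<rho> \<Longrightarrow> 1 \<le> q \<Longrightarrow> q \<le> \<rho>\<^sup>2 \<Longrightarrow> 0 \<le> second_last_gap \<alpha> r q"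
    and small: "(T - a0) / real N \<le> a0 * (\<rho> - 1) / 2"
  shows "graded_mesh (\<lambda>i. ln (tgrid a0 T N i)) \<alpha> \<rho>"
proof -
  define \<tau> where "\<tau> = (T - a0) / real N"
  define t where "t = tgrid a0 T N"
  have \<tau>: "0 < \<tau>" using assms by (simp add: \<tau>_def)
  have tS: "t (Suc i) = t i + \<tau>" for i by (simp add: t_def tgrid_def \<tau>_def algebra_simps flip: add_divide_distrib)
  have ta: "a0 \<le> t i" for i using \<tau> by (simp add: t_def tgrid_def flip: \<tau>_def)
  have tp: "0 < t i" for i using ta[of i] assms by simp
  have dl: "ln (t (Suc i)) - ln (t i) = ln (1 + \<tau> / t i)" for i
  proof -
    have "t (Suc i) / t i = 1 + \<tau> / t i" using tp[of i] by (simp add: tS add_divide_distrib)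
    then show ?thesis using ln_div[of "t (Suc i)" "t i"] tp[of i] tp[of "Suc i"] by simp
  qed
  have up: "ln (t (Suc i)) - ln (t i) \<le> \<tau> / t i" for i
    unfolding dl using \<tau> tp[of i] by (intro ln_add_one_self_le_self) auto
  have lo: "\<tau> / t (Suc i) \<le> ln (t (Suc i)) - ln (t i)" for i
  proof -
    have "ln (t i / t (Suc i)) \<le> t i / t (Suc i) - 1"
      using tp[of i] tp[of "Suc i"] by (intro ln_le_minus_one) auto
    also have "\<dots> = - (\<tau> / t (Suc i))" using tp[of "Suc i"] by (simp add: tS field_simps)
    finally show ?thesis using tp[of i] tp[of "Suc i"] by (simp add: ln_div)
  qed
  have "graded_mesh (\<lambda>i. ln (t i)) \<alpha> \<rho>"
  proof
    show "ln (t i) < ln (t (Suc i))" for i using tp[of i] \<tau> by (simp add: tS)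
    show "ln (t (Suc (Suc i))) - ln (t (Suc i)) \<le> ln (t (Suc i)) - ln (t i)" for i
    proof -
      have "\<tau> / t (Suc i) \<le> \<tau> / t i" using \<tau> tp[of i] by (intro divide_left_mono) (auto simp: tS)
      then show ?thesis unfolding dl using \<tau> tp[of i] tp[of "Suc i"] by (subst ln_le_cancel_iff) (auto intro: add_pos_pos)
    qed
    show "ln (t (Suc i)) - ln (t i) \<le> \<rho> * (ln (t (Suc (Suc i))) - ln (t (Suc i)))" for i
    proof -
      have "2 * \<tau> \<le> a0 * (\<rho> - 1)" using small unfolding \<tau>_def[symmetric] by simp
      also have "\<dots> \<le> t i * (\<rho> - 1)" using ta rho by (intro mult_right_mono) auto
      finally have "t (Suc (Suc i)) \<le> \<rho> * t i" by (simp add: tS algebra_simps)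
      then have "\<tau> / t i \<le> \<rho> * (\<tau> / t (Suc (Suc i)))"
        using \<tau> tp[of i] tp[of "Suc (Suc i)"] by (simp add: field_simps)
      also have "\<dots> \<le> \<rho> * (ln (t (Suc (Suc i))) - ln (t (Suc i)))"
        using lo[of "Suc i"] rho by (intro mult_left_mono) auto
      finally show ?thesis using up[of i] by linarith
    qed
  qed (use assms in auto)
  then show ?thesis by (simp add: t_def)
qed

theorem theorem4p3:
  fixes \<alpha> \<beta> a0 T L :: real
  assumes "0 < \<alpha>" "\<alpha> < 0.3738" "1 < \<beta>" "\<beta> < 2" "0 < a0" "a0 < T" "0 < L"
  shows "\<exists>\<tau>0 > 0. \<exists>h0 > 0. \<forall>(N::nat) (M::nat) u0 f U.
     0 < N \<longrightarrow> 0 < M \<longrightarrow> (T - a0) / real N \<le> \<tau>0 \<longrightarrow> 2 * L / real M \<le> h0 \<longrightarrow>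
     L12_solution \<alpha> \<beta> a0 T L N M u0 f U \<longrightarrow>
     (\<forall>n\<in>{1..N}.
        l2h_norm (2 * L / real M) M (U n)
          \<le> l2h_norm (2 * L / real M) M (U 0)
            + max (6 * Gamma (1 - \<alpha>) / a0 powr \<alpha>) (3 * Gamma (2 - \<alpha>) / (\<alpha> * a0 powr \<alpha>))
              * Max ((\<lambda>k. (real k * ((T - a0) / real N)) powr \<alpha> *
                   l2h_norm (2 * L / real M) M
                     (\<lambda>j m. f (- L + real j * (2 * L / real M)) (- L + real m * (2 * L / real M))
                              (tgrid a0 T N k))) ` {1..n}))"
proof -
  obtain \<rho> where \<rho>: "1 < \<rho>" "\<rho> \<le> 1.02"
    "\<And>r. 1 \<le> r \<Longrightarrow> r \<le> \<rho> \<Longrightarrow> 0 \<le> last_gap \<alpha> r"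
    "\<And>r q. 1 \<le> r \<Longrightarrow> r \<le> \<rho> \<Longrightarrow> 1 \<le> q \<Longrightarrow> q \<le> \<rho>\<^sup>2 \<Longrightarrow> 0 \<le> second_last_gap \<alpha> r q"
    using gaps_nonneg_near_one[OF assms(1,2)] by metis
  define C where "C = max (6 * Gamma (1 - \<alpha>) / a0 powr \<alpha>) (3 * Gamma (2 - \<alpha>) / (\<alpha> * a0 powr \<alpha>))"
  have stable: "l2h_norm (2 * L / real M) M (U n) \<le> l2h_norm (2 * L / real M) M (U 0)
      + C * Max ((\<lambda>k. (real k * ((T - a0) / real N)) powr \<alpha> * l2h_norm (2 * L / real M) M
          (\<lambda>j m. f (- L + real j * (2 * L / real M)) (- L + real m * (2 * L / real M)) (tgrid a0 T N k))) ` {1..n})"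
    if N: "0 < N" and M: "0 < M" and small: "(T - a0) / real N \<le> a0 * (\<rho> - 1) / 2"
      and sol: "L12_solution \<alpha> \<beta> a0 T L N M u0 f U" and n: "n \<in> {1..N}" for N M n :: nat and u0 f U
  proof -
    define h \<tau> where "h = 2 * L / real M" and "\<tau> = (T - a0) / real N"
    define t where "t = tgrid a0 T N"
    define F where "F = (\<lambda>n j m. f (- L + real j * h) (- L + real m * h) (t n))"
    define c where "c = c_coef \<alpha> t"
    define s where "s = (\<lambda>i. ln (t i))"
    have \<tau>: "0 < \<tau>" using assms N by (simp add: \<tau>_def)
    interpret graded_mesh s \<alpha> \<rho>
      unfolding s_def t_def using assms N \<rho> small by (intro log_grid_graded_mesh) auto
    have tp: "0 < t i" for i
      using assms N by (auto simp: t_def tgrid_def intro!: add_pos_nonneg)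
    have c: "c i k = L12_weight \<alpha> s i k / Gamma (2 - \<alpha>)" if "1 \<le> i" "i \<le> k" for i k
      using c_coef_eq_weight[of i k t \<alpha>] that tp by (simp add: c_def s_def)
    have G: "0 < Gamma (2 - \<alpha>)" "0 < Gamma (1 - \<alpha>)" using assms by (auto intro!: Gamma_real_pos)
    have G2: "Gamma (2 - \<alpha>) = (1 - \<alpha>) * Gamma (1 - \<alpha>)"
      using Gamma_plus1[of "1 - \<alpha>"] nonpos_Ints_nonpos[of "1 - \<alpha>"] assms by fastforce
    have mono: "c i k \<le> c (i + 1) k" if "1 \<le> i" "i < k" for i k
      using weight_mono[OF that] that G by (simp add: c divide_right_mono)
    have c1: "0 < c 1 k" if "1 \<le> k" for k
    proof -
      have "0 < (1 - \<alpha>) * (s k - s 0) powr (-\<alpha>) / 6"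
        using assms strict_mono_s[of 0 k] that by simp
      also have "\<dots> \<le> L12_weight \<alpha> s 1 k" by (rule weight_first_ge[OF that])
      finally show ?thesis using G that by (simp add: c)
    qed
    \<comment> \<open>Source of the constant: \<open>ln y \<le> y - 1\<close> bounds the logarithmic
      distance by \<open>k * \<tau> / a0\<close>, and
      \<open>Gamma (2 - \<alpha>) = (1 - \<alpha>) * Gamma (1 - \<alpha>)\<close> cancels the factor
      \<open>1 - \<alpha>\<close> of the lower bound on the first weight.\<close>
    have first: "1 \<le> c 1 k * (C * (real k * \<tau>) powr \<alpha>)" if "1 \<le> k" for k
    proof -
      define X where "X = s k - s 0"
      have X: "0 < X" using strict_mono_s[of 0 k] that by (simp add: X_def)
      have k\<tau>: "0 < real k * \<tau>" using that \<tau> by simp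
      have "X = ln (t k / t 0)" using tp[of 0] tp[of k] by (simp add: X_def s_def ln_div)
      also have "\<dots> \<le> t k / t 0 - 1" using tp by (intro ln_le_minus_one) auto
      also have "\<dots> = real k * \<tau> / a0" using assms by (simp add: t_def tgrid_def \<tau>_def field_simps)
      finally have "X powr \<alpha> \<le> (real k * \<tau> / a0) powr \<alpha>" using X assms by (intro powr_mono2) auto
      also have "\<dots> = (real k * \<tau>) powr \<alpha> / a0 powr \<alpha>" using k\<tau> assms by (simp add: powr_divide)
      finally have Xp: "X powr \<alpha> \<le> (real k * \<tau>) powr \<alpha> / a0 powr \<alpha>" .
      have "1 = (1 - \<alpha>) * X powr (-\<alpha>) / 6 / Gamma (2 - \<alpha>) * (6 * Gamma (1 - \<alpha>) * X powr \<alpha>)"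
      proof -
        have "Gamma (1 - \<alpha>) \<noteq> 0" using G(2) by (metis less_irrefl)
        moreover have "1 - \<alpha> \<noteq> 0" using assms by simp
        ultimately show ?thesis using X unfolding G2 by (simp add: powr_minus)
      qed
      also have "\<dots> \<le> c 1 k * (6 * Gamma (1 - \<alpha>) * ((real k * \<tau>) powr \<alpha> / a0 powr \<alpha>))"
      proof (rule mult_mono)
        show "(1 - \<alpha>) * X powr (-\<alpha>) / 6 / Gamma (2 - \<alpha>) \<le> c 1 k"
          unfolding c[OF order.refl that] X_def
          by (rule divide_right_mono[OF weight_first_ge[OF that] less_imp_le[OF G(1)]])
        show "6 * Gamma (1 - \<alpha>) * X powr \<alpha> \<le> 6 * Gamma (1 - \<alpha>) * ((real k * \<tau>) powr \<alpha> / a0 powr \<alpha>)"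
          using Xp less_imp_le[OF G(2)] by (intro mult_left_mono) auto
        show "0 \<le> c 1 k" by (rule less_imp_le[OF c1[OF that]])
        show "0 \<le> 6 * Gamma (1 - \<alpha>) * X powr \<alpha>" using less_imp_le[OF G(2)] by simp
      qed
      also have "\<dots> \<le> c 1 k * (C * (real k * \<tau>) powr \<alpha>)"
      proof -
        have "6 * Gamma (1 - \<alpha>) / a0 powr \<alpha> * (real k * \<tau>) powr \<alpha> \<le> C * (real k * \<tau>) powr \<alpha>"
          unfolding C_def by (intro mult_right_mono) auto
        then show ?thesis using c1[OF that] by (intro mult_left_mono) auto
      qed
      finally show ?thesis .
    qed
    define B where "B = Max ((\<lambda>k. (real k * \<tau>) powr \<alpha> * l2h_norm h M (F k)) ` {1..n})"
    have "l2h_norm h M (U n) \<le> l2h_norm h M (U 0) + C * B"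
    \<comment> \<open>The horizon is \<open>n\<close> itself, since the maximum \<open>B\<close>
      only controls the data up to time level \<open>n\<close>.\<close>
    proof (rule weighted_gronwall[where N = n and c = c and F = "\<lambda>k. l2h_norm h M (F k)"])
      fix k assume k: "1 \<le> k" "k \<le> n"
      show "c k k * l2h_norm h M (U k) \<le> (\<Sum>i\<in>{1..k-1}. (c (i + 1) k - c i k) * l2h_norm h M (U i))
          + c 1 k * l2h_norm h M (U 0) + l2h_norm h M (F k)"
        using sol assms M k n mono c1[OF k(1)]
        by (intro L12_solution_energy_step[OF sol]) (auto simp: c_def h_def F_def t_def)
      show "0 < c 1 k" by (rule c1[OF k(1)])
      have "(real k * \<tau>) powr \<alpha> * l2h_norm h M (F k) \<le> B"
        unfolding B_def using k by (intro Max_ge) auto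
      moreover have "0 \<le> C" using G assms by (auto simp: C_def le_max_iff_disj)
      ultimately have "c 1 k * C * ((real k * \<tau>) powr \<alpha> * l2h_norm h M (F k)) \<le> c 1 k * C * B"
        using c1[OF k(1)] by (intro mult_left_mono) auto
      moreover have "1 * l2h_norm h M (F k) \<le> c 1 k * (C * (real k * \<tau>) powr \<alpha>) * l2h_norm h M (F k)"
        using first[OF k(1)] by (intro mult_right_mono) (auto simp: l2h_norm_def intro!: mult_nonneg_nonneg sum_nonneg)
      ultimately show "l2h_norm h M (F k) \<le> c 1 k * (C * B)" by (simp add: mult.assoc)
    qed (use mono n in auto)
    then show ?thesis by (simp add: B_def F_def h_def \<tau>_def t_def)
  qed
  show ?thesis
  \<comment> \<open>This time step bound keeps the ratio of adjacent logarithmic steps at most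
    \<open>\<rho>\<close>; it depends on \<open>\<alpha>\<close> and \<open>a0\<close>
    alone.\<close>
  proof (rule exI[of _ "a0 * (\<rho> - 1) / 2"], intro conjI exI[of _ "1::real"] allI impI ballI)
    show "0 < a0 * (\<rho> - 1) / 2" using assms \<rho> by simp
  qed (use stable in \<open>auto simp: C_def\<close>)
qed

end
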